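(* Let $M=\{1^{p_1},2^{p_2},\dots,n^{p_n}\}$ be a multiset (with $n\ge1$ and all $p_i\ge 1$), and let $T\in\mathcal P_M$ be a weakly increasing tree on $M$. For any node $v$ of $T$, if $v\leadsto u$ (in $T$), then $$\mathsf{lev}_T(v)=\mathsf{lsw}_{\tilde\phi(T)}(u),\quad \mathsf{lsw}_T(v)=\mathsf{lev}_{\tilde\phi(T)}(u)\quad\text{and}\quad \mathsf{deg}_T(v)=\widetilde{\mathsf{deg}}_{\tilde\phi(T)}(u).$$ Consequently, the two septuples $$(\mathsf{Lev},\mathsf{Lsw},\mathsf{Bro},\mathsf{Par},\mathsf{Yle},\mathsf{leaf},\mathsf{int})\quad\text{and}\quad(\mathsf{Lsw},\mathsf{Lev},\mathsf{Par},\mathsf{Bro},\mathsf{Yle},\mathsf{int},\mathsf{leaf})$$ have the same distribution over $\mathcal P_M$.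
   Context: **Weakly increasing trees.** A plane tree is a rooted tree in which the children of each node are linearly ordered (left to right). For $M=\{1^{p_1},\dots,n^{p_n}\}$ with $p=p_1+\cdots+p_n$, a weakly increasing tree on $M$ is a plane tree with $p+1$ nodes labeled precisely by the elements of the multiset $M\cup\{0\}$ such that (i) labels along any path from the root to a leaf are weakly increasing, and (ii) the labels of the children of each node are weakly increasing from left to right. $\mathcal P_M$ is the set of these trees. A node without children is a leaf; otherwise it is internal. Nodes with the same parent are siblings; siblings to the left (right) of a node are its elder (younger) siblings. **Weakly increasing binary trees and $\tilde\phi$.** A binary tree is a rooted tree in which each node has at most one left child and at most one right child. $\mathcal B_M$ is the set of labeled binary trees whose labels form precisely $M$ and whose labels weakly increase along each path from the root to a leaf. The bijection $\varphi:\mathcal P_M\to\mathcal B_M$: the nodes of $\varphi(T)$ are the non-root nodes of $T$ with their labels; its root is the leftmost child of the root of $T$; for non-root nodes $x,y$, $y$ is the left child of $x$ in $\varphi(T)$ iff $y$ is the leftmost child of $x$ in $T$, and $y$ is the right child of $x$ in $\varphi(T)$ iff $x$ is the closest elder sibling of $y$ in $T$. For a binary tree $B$, $\phi(B)$ is its mirror image (same labeled nodes, left and right children exchanged). Put $\tilde\phi=\varphi^{-1}\circ\phi\circ\varphi:\mathcal P_M\to\mathcal P_M$. The nodes of $T$ and of $\tilde\phi(T)$ are identified (root with root). **The relation $\leadsto$.** Let $B=\varphi(T)$. Add new nodes to $B$ so that every node of $B$ has exactly two children, obtaining the complement $\overline B$. Each added node is named after a node of $T$: if it is a left child of a node $v$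 of $B$, it is named $v'$; if it is a right child of a node $v$ of $B$, it is named $u'$, where $u$ is the parent of $v$ in $T$. Define $\overline{\phi(B)}$ in the same way using $\tilde\phi(T)$ in place of $T$. For every node $v$ of $T$ there is a unique node $u$ such that either $v'$ is the right child of $u$ in $\overline B$, or $u'$ is the right child of $v$ in $\overline{\phi(B)}$; one writes $v\leadsto u$. **Statistics of a node $v$ of $T$.** - $\mathsf{lev}_T(v)$: number of edges on the path from $v$ to the root. - $\mathsf{lsw}_T(v)$: the number of children of $v$ plus the number of edges attached to nodes other than $v$ on the path from $v$ to the root from the left-hand side (equivalently, the number of children of $v$ plus the total number of elder siblings of the non-root nodes on that path, $v$ included). - $\mathsf{deg}_T(v)$: number of children of $v$. - $\widetilde{\mathsf{deg}}_T(v)$: $0$ if $v$ is internal; $\mathsf{lev}_T(v)$ if $v$ is a leaf and no node on the path from $v$ to the root has elder siblings; otherwise the number of nodes from $v$ to the first node having elder siblings (both included) when walking from $v$ to the root. **Statistics of a tree $T\in\mathcal P_M$.** $\mathsf{leaf}(T)$ and $\mathsf{int}(T)$ are the numbers of leaves and internal nodes. $\mathsf{Lev}(T)$ and $\mathsf{Lsw}(T)$ are the multisets of $\mathsf{lev}_T(v)$ and of $\mathsf{lsw}_T(v)$ over all nodes $v$. $\mathsf{Bro}(T)$ is the multiset of labels of the repeated siblings, i.e. nodes having an elder sibling with the same label. $\mathsf{Par}(T)$ is the multiset of labels of the repeated parents, i.e. nodes having a child with the same label (one contribution per such node). $\mathsf{Yle}(T)$ is the multiset of labels of the young leaves, i.e.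 leaves that are the rightmost child of their parent. Two tuples of statistics have the same distribution over a finite set if every tuple of values is attained by equally many elements of the set. *)

theory Defs
  imports Main "HOL-Library.Multiset" "HOL-Library.Tree"
begin

section \<open>Plane trees whose nodes carry names\<close>

datatype (nodes: 'a) ptree = PNode (proot: 'a) (branches: "'a ptree list")
  for map: relabel

primrec subptrees :: "'a ptree \<Rightarrow> 'a ptree set" where
  "subptrees (PNode x ts) = insert (PNode x ts) (\<Union>(set (map subptrees ts)))"

text \<open>
  The notions below that take a node as an argument are meant for trees in which distinct nodes
  have distinct names, i.e. \<^term>\<open>inj_on proot (subptrees T)\<close>; a node is then the same thing as
  its name.  Labels may repeat, so a labelled tree \<open>T :: nat ptree\<close> first has to be given
  node names.  This is done by \<open>addressed\<close>: the node becomes the pair of its address (positions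
  of the branches taken from the root) and its label.
\<close>

primrec addressed :: "'a ptree \<Rightarrow> (nat list \<times> 'a) ptree" where
  "addressed (PNode x ts) =
     PNode ([], x)
       (map2 (\<lambda>i. relabel (\<lambda>(a, l). (i # a, l))) [0..<length ts] (map addressed ts))"

definition kids :: "'v ptree \<Rightarrow> 'v \<Rightarrow> 'v list" where
  "kids T v = map proot (branches (THE t. t \<in> subptrees T \<and> proot t = v))"

text \<open>Meaningful for nodes other than the root.\<close>

definition parent :: "'v ptree \<Rightarrow> 'v \<Rightarrow> 'v" where
  "parent T v = (THE u. u \<in> nodes T \<and> v \<in> set (kids T u))"

definition elder_siblings :: "'v ptree \<Rightarrow> 'v \<Rightarrow> 'v set" where
  "elder_siblings T v =
     {w. \<exists>u\<in>nodes T. \<exists>i j. i < j \<and> j < length (kids T u) \<and> w = kids T u ! i \<and> v = kids T u ! j}"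

text \<open>The nodes on the path from \<open>v\<close> to the root, starting with \<open>v\<close> and ending with the root.\<close>

definition root_path :: "'v ptree \<Rightarrow> 'v \<Rightarrow> 'v list" where
  "root_path T v =
     (THE xs. xs \<noteq> [] \<and> set xs \<subseteq> nodes T \<and> hd xs = v \<and> last xs = proot T \<and>
              successively (\<lambda>x y. x \<in> set (kids T y)) xs)"

section \<open>Weakly increasing trees\<close>

text \<open>The tree \<open>T\<close> carries the labels; the root necessarily gets the label \<open>0\<close> if all elements
  of \<open>M\<close> are positive.\<close>

definition wi_trees :: "nat multiset \<Rightarrow> nat ptree set" where
  "wi_trees M =
     {T. let N = addressed T in
         image_mset snd (mset_set (nodes N)) = add_mset 0 M \<and>
         (\<forall>v\<in>nodes N. kids N v = [] \<longrightarrow> sorted (rev (map snd (root_path N v)))) \<and>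
         (\<forall>v\<in>nodes N. sorted (map snd (kids N v)))}"

section \<open>The bijection with binary trees and the induced map\<close>

fun forest_to_bin :: "'v ptree list \<Rightarrow> 'v tree" where
  "forest_to_bin [] = Leaf"
| "forest_to_bin (PNode x cs # ts) = Node (forest_to_bin cs) x (forest_to_bin ts)"

text \<open>The map \<open>\<phi>\<close> forgets the root; the lemmas \<open>left_child_phi\<close> and \<open>right_child_phi\<close>
  below give its usual description by leftmost children and next younger siblings.\<close>

definition phi :: "'v ptree \<Rightarrow> 'v tree" where
  "phi T = forest_to_bin (branches T)"

primrec bin_to_forest :: "'v tree \<Rightarrow> 'v ptree list" where
  "bin_to_forest Leaf = []"
| "bin_to_forest (Node l x r) = PNode x (bin_to_forest l) # bin_to_forest r"

definition phi_inv :: "'v \<Rightarrow> 'v tree \<Rightarrow> 'v ptree" where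
  "phi_inv r B = PNode r (bin_to_forest B)"

text \<open>Since the node names are moved around together with the nodes, the nodes of \<open>T\<close> and those
  of \<open>phi_tilde T\<close> are identified by having the same name.\<close>

definition phi_tilde :: "'v ptree \<Rightarrow> 'v ptree" where
  "phi_tilde T = phi_inv (proot T) (mirror (phi T))"

definition left_child :: "'a tree \<Rightarrow> 'a \<Rightarrow> 'a \<Rightarrow> bool" where
  "left_child B x y \<longleftrightarrow> (\<exists>l r r'. Node (Node l y r) x r' \<in> subtrees B)"

definition right_child :: "'a tree \<Rightarrow> 'a \<Rightarrow> 'a \<Rightarrow> bool" where
  "right_child B x y \<longleftrightarrow> (\<exists>l l' r'. Node l x (Node l' y r') \<in> subtrees B)"

section \<open>The complement and the relation between nodes\<close>

text \<open>\<open>Orig v\<close> is the node \<open>v\<close> itself, \<open>Added v\<close> is the added node called \<open>v'\<close>.\<close>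

datatype 'v cnode = Orig 'v | Added 'v

fun complete_bin :: "('v \<Rightarrow> 'v) \<Rightarrow> 'v tree \<Rightarrow> 'v cnode tree" where
  "complete_bin par Leaf = Leaf"
| "complete_bin par (Node l v r) =
     Node (if l = Leaf then Node Leaf (Added v) Leaf else complete_bin par l)
          (Orig v)
          (if r = Leaf then Node Leaf (Added (par v)) Leaf else complete_bin par r)"

text \<open>The complement of \<open>phi T\<close>; the names of the added nodes depend on \<open>T\<close>.\<close>

definition complement :: "'v ptree \<Rightarrow> 'v cnode tree" where
  "complement T = complete_bin (parent T) (phi T)"

text \<open>As \<open>phi (phi_tilde T) = mirror (phi T)\<close>, the second complement is that of the mirror image
  of \<open>phi T\<close>, named by means of \<open>phi_tilde T\<close>.\<close>

definition leads_to :: "'v ptree \<Rightarrow> 'v \<Rightarrow> 'v \<Rightarrow> bool" where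
  "leads_to T v u \<longleftrightarrow>
     right_child (complement T) (Orig u) (Added v) \<or>
     right_child (complement (phi_tilde T)) (Orig v) (Added u)"

section \<open>Statistics of a node\<close>

definition lev :: "'v ptree \<Rightarrow> 'v \<Rightarrow> nat" where
  "lev T v = length (root_path T v) - 1"

definition deg :: "'v ptree \<Rightarrow> 'v \<Rightarrow> nat" where
  "deg T v = length (kids T v)"

text \<open>An edge attached from the left to a node \<open>u\<close> of the path from \<open>v\<close> to the root, \<open>u \<noteq> v\<close>,
  leads to an elder sibling of the path node below \<open>u\<close>; the root has no elder siblings.\<close>

definition lsw :: "'v ptree \<Rightarrow> 'v \<Rightarrow> nat" where
  "lsw T v = deg T v + (\<Sum>w\<leftarrow>root_path T v. card (elder_siblings T w))"

definition deg_tilde :: "'v ptree \<Rightarrow> 'v \<Rightarrow> nat" where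
  "deg_tilde T v =
     (if kids T v \<noteq> [] then 0
      else if \<forall>w\<in>set (root_path T v). elder_siblings T w = {} then lev T v
      else length (takeWhile (\<lambda>w. elder_siblings T w = {}) (root_path T v)) + 1)"

section \<open>Statistics of a tree\<close>

text \<open>A node is a pair whose second component is its label; the first component serves only to
  keep nodes with equal labels apart.\<close>

definition Lev :: "('i \<times> nat) ptree \<Rightarrow> nat multiset" where
  "Lev T = image_mset (lev T) (mset_set (nodes T))"

definition Lsw :: "('i \<times> nat) ptree \<Rightarrow> nat multiset" where
  "Lsw T = image_mset (lsw T) (mset_set (nodes T))"

definition Bro :: "('i \<times> nat) ptree \<Rightarrow> nat multiset" where
  "Bro T = image_mset snd (mset_set {v \<in> nodes T. \<exists>w\<in>elder_siblings T v. snd w = snd v})"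

definition Par :: "('i \<times> nat) ptree \<Rightarrow> nat multiset" where
  "Par T = image_mset snd (mset_set {v \<in> nodes T. \<exists>w\<in>set (kids T v). snd w = snd v})"

definition Yle :: "('i \<times> nat) ptree \<Rightarrow> nat multiset" where
  "Yle T = image_mset snd
     (mset_set {v \<in> nodes T. kids T v = [] \<and> (\<exists>u\<in>nodes T. kids T u \<noteq> [] \<and> v = last (kids T u))})"

definition leaf_count :: "('i \<times> nat) ptree \<Rightarrow> nat" where
  "leaf_count T = card {v \<in> nodes T. kids T v = []}"

definition int_count :: "('i \<times> nat) ptree \<Rightarrow> nat" where
  "int_count T = card {v \<in> nodes T. kids T v \<noteq> []}"

text \<open>Used for finite \<open>S\<close> only, see \<open>finite_wi_trees\<close>.\<close>

definition same_distribution :: "'a set \<Rightarrow> ('a \<Rightarrow> 'b) \<Rightarrow> ('a \<Rightarrow> 'b) \<Rightarrow> bool" where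
  "same_distribution S f g \<longleftrightarrow> (\<forall>z. card {x \<in> S. f x = z} = card {x \<in> S. g x = z})"

section \<open>Basic facts\<close>

lemma proot_relabel [simp]: "proot (relabel f t) = f (proot t)"
  by (cases t) simp

lemma subptrees_relabel: "subptrees (relabel f t) = relabel f ` subptrees t"
  by (induction t) auto

lemma proot_image_subptrees: "proot ` subptrees t = nodes t"
  by (induction t) (auto simp: image_UN image_Union)

lemma subptrees_addressed:
  "subptrees (addressed (PNode x ts)) =
     insert (addressed (PNode x ts))
       (\<Union>i<length ts. relabel (\<lambda>(a, l). (i # a, l)) ` subptrees (addressed (ts ! i)))"
  by (force simp: set_zip subptrees_relabel)

lemma nodes_addressed:
  "nodes (addressed (PNode x ts)) =
     insert ([], x) (\<Union>i<length ts. (\<lambda>(a, l). (i # a, l)) ` nodes (addressed (ts ! i)))"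
proof -
  have "nodes (addressed (PNode x ts)) = proot ` subptrees (addressed (PNode x ts))"
    by (rule proot_image_subptrees[symmetric])
  also have "\<dots> = insert ([], x)
      (\<Union>i<length ts. proot ` subptrees (relabel (\<lambda>(a, l). (i # a, l)) (addressed (ts ! i))))"
    unfolding subptrees_addressed subptrees_relabel image_insert image_UN by simp
  finally show ?thesis
    unfolding proot_image_subptrees ptree.set_map .
qed

lemma inj_on_proot_addressed: "inj_on proot (subptrees (addressed T))"
proof (induction T)
  case (PNode x ts)
  let ?f = "\<lambda>i. (\<lambda>(a, l). (i # a, l)) :: nat list \<times> 'a \<Rightarrow> nat list \<times> 'a"
  note sub = subptrees_addressed[of x ts]
  show ?case
  proof (rule inj_onI)
    fix s t assume "s \<in> subptrees (addressed (PNode x ts))" "t \<in> subptrees (addressed (PNode x ts))"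
      and eq: "proot s = proot t"
    then consider "s = addressed (PNode x ts)" "t = addressed (PNode x ts)"
      | i s' j t' where "i < length ts" "s' \<in> subptrees (addressed (ts ! i))" "s = relabel (?f i) s'"
          "j < length ts" "t' \<in> subptrees (addressed (ts ! j))" "t = relabel (?f j) t'"
      unfolding sub by (auto split: prod.splits)
    then show "s = t"
    proof cases
      case 2
      then have "i = j" "proot s' = proot t'"
        using eq by (auto split: prod.splits simp: prod_eq_iff)
      moreover have "ts ! i \<in> set ts" using 2 by simp
      ultimately have "s' = t'" using PNode[of "ts ! i"] 2 by (auto dest: inj_onD)
      then show ?thesis using 2 \<open>i = j\<close> by simp
    qed simp
  qed
qed

lemma relabel_snd_addressed: "relabel snd (addressed T) = T"
proof (induction T)
  case (PNode x ts)
  have *: "relabel snd (relabel (\<lambda>(a, l). (i # a, l)) s) = relabel snd s"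
    for i and s :: "(nat list \<times> 'a) ptree"
    by (auto simp: ptree.map_comp comp_def case_prod_beta)
  show ?case
    by (rule ptree.expand) (auto simp: * PNode intro!: nth_equalityI)
qed

lemma bin_to_forest_to_bin: "bin_to_forest (forest_to_bin ts) = ts"
  by (induction ts rule: forest_to_bin.induct) auto

lemma forest_to_bin_to_forest: "forest_to_bin (bin_to_forest B) = B"
  by (induction B) auto

lemma phi_inv_phi: "phi_inv (proot T) (phi T) = T"
  by (simp add: phi_inv_def phi_def bin_to_forest_to_bin)

lemma phi_phi_inv: "phi (phi_inv r B) = B"
  by (simp add: phi_inv_def phi_def forest_to_bin_to_forest)

lemma phi_phi_tilde: "phi (phi_tilde T) = mirror (phi T)"
  by (simp add: phi_tilde_def phi_phi_inv)

lemma nodes_phi_tilde: "nodes (phi_tilde T) = nodes T"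
proof -
  have 1: "set_tree (forest_to_bin ts) = \<Union>(nodes ` set ts)" for ts :: "'a ptree list"
    by (induction ts rule: forest_to_bin.induct) auto
  have 2: "\<Union>(nodes ` set (bin_to_forest B)) = set_tree B" for B :: "'a tree"
    by (induction B) auto
  have 3: "set_tree (mirror B) = set_tree B" for B :: "'a tree"
    by (induction B) auto
  show ?thesis
    by (cases T) (simp add: phi_tilde_def phi_inv_def phi_def 1 2 3)
qed

text \<open>The map \<open>phi_tilde\<close> does not depend on how the nodes are named.\<close>

lemma phi_tilde_relabel: "phi_tilde (relabel f T) = relabel f (phi_tilde T)"
proof -
  have 1: "forest_to_bin (map (relabel f) ts) = map_tree f (forest_to_bin ts)" for ts
    by (induction ts rule: forest_to_bin.induct) auto
  have 2: "bin_to_forest (map_tree f B) = map (relabel f) (bin_to_forest B)" for B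
    by (induction B) auto
  have 3: "mirror (map_tree f B) = map_tree f (mirror B)" for B
    by (induction B) auto
  show ?thesis
    by (cases T) (simp add: phi_tilde_def phi_inv_def phi_def 1 2 3)
qed

lemma left_child_Node:
  "left_child (Node l z r) x y \<longleftrightarrow>
     z = x \<and> (\<exists>a b. l = Node a y b) \<or> left_child l x y \<or> left_child r x y"
  unfolding left_child_def by auto

lemma right_child_Node:
  "right_child (Node l z r) x y \<longleftrightarrow>
     z = x \<and> (\<exists>a b. r = Node a y b) \<or> right_child l x y \<or> right_child r x y"
  unfolding right_child_def by auto

lemma left_child_phi:
  "left_child (phi T) x y \<longleftrightarrow>
     (\<exists>b\<in>set (branches T). \<exists>t\<in>subptrees b. \<exists>bs. proot t = x \<and> map proot (branches t) = y # bs)"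
proof -
  have "left_child (forest_to_bin ts) x y \<longleftrightarrow>
     (\<exists>b\<in>set ts. \<exists>t\<in>subptrees b. \<exists>bs. proot t = x \<and> map proot (branches t) = y # bs)" for ts
  proof (induction ts rule: forest_to_bin.induct)
    case (2 z cs ts)
    have "left_child (forest_to_bin (PNode z cs # ts)) x y \<longleftrightarrow>
        (z = x \<and> (\<exists>bs. map proot cs = y # bs)) \<or>
        left_child (forest_to_bin cs) x y \<or> left_child (forest_to_bin ts) x y"
      by (cases cs rule: forest_to_bin.cases) (simp_all add: left_child_Node)
    then show ?case
      unfolding 2 by auto
  qed (simp add: left_child_def)
  then show ?thesis by (simp add: phi_def)
qed

lemma right_child_phi:
  "right_child (phi T) x y \<longleftrightarrow>
     (\<exists>t\<in>subptrees T. \<exists>as bs. map proot (branches t) = as @ x # y # bs)"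
proof -
  have "right_child (forest_to_bin ts) x y \<longleftrightarrow>
     (\<exists>as bs. map proot ts = as @ x # y # bs) \<or>
     (\<exists>b\<in>set ts. \<exists>t\<in>subptrees b. \<exists>as bs. map proot (branches t) = as @ x # y # bs)" for ts
  proof (induction ts rule: forest_to_bin.induct)
    case (2 z cs ts)
    have "right_child (forest_to_bin (PNode z cs # ts)) x y \<longleftrightarrow>
        (z = x \<and> (\<exists>bs. map proot ts = y # bs)) \<or>
        right_child (forest_to_bin cs) x y \<or> right_child (forest_to_bin ts) x y"
      by (cases ts rule: forest_to_bin.cases) (simp_all add: right_child_Node)
    moreover have "(\<exists>as bs. map proot (PNode z cs # ts) = as @ x # y # bs) \<longleftrightarrow>
        (z = x \<and> (\<exists>bs. map proot ts = y # bs)) \<or> (\<exists>as bs. map proot ts = as @ x # y # bs)"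
      (is "?L \<longleftrightarrow> ?R")
    proof
      assume ?L
      then show ?R by (auto simp: Cons_eq_append_conv)
    next
      assume ?R
      then show ?L
      proof
        assume "z = x \<and> (\<exists>bs. map proot ts = y # bs)"
        then have "\<exists>bs. map proot (PNode z cs # ts) = [] @ x # y # bs" by simp
        then show ?L by blast
      next
        assume "\<exists>as bs. map proot ts = as @ x # y # bs"
        then obtain as bs where "map proot (PNode z cs # ts) = (z # as) @ x # y # bs" by auto
        then show ?L by blast
      qed
    qed
    ultimately show ?case
      unfolding 2 by auto
  qed (simp add: right_child_def)
  then show ?thesis
    by (cases T) (simp add: phi_def)
qed

lemma finite_nodes: "finite (nodes T)"
  by (induction T) auto

lemma finite_wi_trees: "finite (wi_trees M)"
proof -
  let ?c = "\<lambda>T :: nat ptree. card (nodes (addressed T))"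
  define S where "S k = {T. ?c T \<le> k \<and> nodes T \<subseteq> set_mset (add_mset 0 M)}" for k
  have branch: "?c b < ?c (PNode x ts) \<and> length ts < ?c (PNode x ts)" if b: "b \<in> set ts" for b x ts
  proof -
    obtain i where i: "i < length ts" "b = ts ! i"
      using b by (metis in_set_conv_nth)
    define f :: "nat \<Rightarrow> nat list \<times> nat \<Rightarrow> nat list \<times> nat" where "f = (\<lambda>i (a, l). (i # a, l))"
    have f: "f i v \<noteq> ([], x)" "f i v = f j w \<longleftrightarrow> i = j \<and> v = w" for i j v w
      by (auto simp: f_def split: prod.splits)
    have nd: "nodes (addressed (PNode x ts)) =
        insert ([], x) (\<Union>j<length ts. f j ` nodes (addressed (ts ! j)))"
      unfolding f_def by (rule nodes_addressed)
    have "?c b = card (f i ` nodes (addressed b))"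
      by (rule card_image[symmetric]) (simp add: inj_on_def f)
    also have "\<dots> < ?c (PNode x ts)"
    proof (rule psubset_card_mono[OF finite_nodes psubsetI])
      show "f i ` nodes (addressed b) \<subseteq> nodes (addressed (PNode x ts))"
        unfolding nd i(2) using i(1) by blast
      have "([], x) \<notin> f i ` nodes (addressed b)"
        using f(1) by (metis imageE)
      then show "f i ` nodes (addressed b) \<noteq> nodes (addressed (PNode x ts))"
        unfolding nd by blast
    qed
    finally have 1: "?c b < ?c (PNode x ts)" .
    define g where "g j = f j (proot (addressed (ts ! j)))" for j
    have "length ts = card (g ` {..<length ts})"
      by (subst card_image) (simp_all add: inj_on_def g_def f)
    also have "\<dots> < ?c (PNode x ts)"
    proof (rule psubset_card_mono[OF finite_nodes psubsetI])
      have p: "proot t \<in> nodes t" for t :: "(nat list \<times> nat) ptree"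
        by (cases t) simp
      show "g ` {..<length ts} \<subseteq> nodes (addressed (PNode x ts))"
        unfolding nd g_def using p by blast
      have "([], x) \<notin> g ` {..<length ts}"
        unfolding g_def using f(1) by (metis imageE)
      then show "g ` {..<length ts} \<noteq> nodes (addressed (PNode x ts))"
        unfolding nd by blast
    qed
    finally show ?thesis using 1 by blast
  qed
  have "finite (S k)" for k
  proof (induction k)
    case 0
    have "0 < ?c T" for T
      by (cases T) (simp add: card_gt_0_iff finite_nodes)
    then have "S 0 = {}"
      unfolding S_def by (metis (mono_tags, lifting) empty_Collect_eq not_le)
    then show ?case by simp
  next
    case (Suc k)
    have "S (Suc k) \<subseteq> (\<lambda>(x, ts). PNode x ts) `
        (set_mset (add_mset 0 M) \<times> {ts. set ts \<subseteq> S k \<and> length ts \<le> Suc k})"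
    proof
      fix T assume T: "T \<in> S (Suc k)"
      obtain x ts where Tx: "T = PNode x ts" by (cases T)
      have le: "?c (PNode x ts) \<le> Suc k"
        and lab: "nodes (PNode x ts) \<subseteq> set_mset (add_mset 0 M)"
        using T unfolding S_def Tx by blast+
      have "x \<in># add_mset 0 M" using lab by simp
      moreover have "set ts \<subseteq> S k"
      proof
        fix b assume b: "b \<in> set ts"
        then have "nodes b \<subseteq> nodes (PNode x ts)" by auto
        with lab have "nodes b \<subseteq> set_mset (add_mset 0 M)" by blast
        moreover have "?c b \<le> k" using branch[OF b, of x] le by linarith
        ultimately show "b \<in> S k" by (simp add: S_def)
      qed
      moreover have "length ts \<le> Suc k"
      proof (cases "ts = []")
        case False
        then have "length ts < ?c (PNode x ts)" using branch[of "hd ts" ts x] by simp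
        then show ?thesis using le by linarith
      qed simp
      ultimately show "T \<in> (\<lambda>(x, ts). PNode x ts) `
          (set_mset (add_mset 0 M) \<times> {ts. set ts \<subseteq> S k \<and> length ts \<le> Suc k})"
        unfolding Tx by blast
    qed
    then show ?case
      by (rule finite_subset)
         (intro finite_imageI finite_cartesian_product finite_lists_length_le Suc finite_set_mset)
  qed
  moreover have "wi_trees M \<subseteq> S (Suc (size M))"
  proof
    fix T assume "T \<in> wi_trees M"
    then have *: "image_mset snd (mset_set (nodes (addressed T))) = add_mset 0 M"
      by (simp add: wi_trees_def Let_def)
    have "?c T = Suc (size M)"
      using arg_cong[OF *, of size] by simp
    moreover have "nodes T = snd ` nodes (addressed T)"
      by (metis ptree.set_map relabel_snd_addressed)
    then have "nodes T = set_mset (add_mset 0 M)"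
      using arg_cong[OF *, of set_mset] by (simp add: finite_nodes)
    ultimately show "T \<in> S (Suc (size M))"
      by (simp add: S_def)
  qed
  ultimately show ?thesis
    by (rule finite_subset[rotated])
qed

end

theory Submission
  imports Defs
begin

text \<open>
  In the binary tree of \<open>T\<close>, the level of a node counts the left steps and its elder siblings along
  the path to the root count the right steps; mirroring exchanges the two.  An internal node \<open>v\<close> of
  \<open>T\<close> leads to its last child, and a leaf \<open>v\<close> leads to the node whose last child in the mirrored
  tree is \<open>v\<close>.  Hence the relation is symmetric under \<^const>\<open>phi_tilde\<close> and is a bijection on the
  nodes.  Being weakly increasing means that the binary tree is a heap, which is invariant under
  mirroring; a repeated sibling is a right child with the label of its parent, a repeated parent is
  a parent of a left child with its own label, and a young leaf is a leaf of the binary tree.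
\<close>

section \<open>Trees with distinct node names\<close>

text \<open>The obstacle is naming. The node statistics and \<open>leads_to\<close> need distinct
  names, labels repeat, and \<open>addressed (phi_tilde T)\<close> differs in general from
  \<open>phi_tilde (addressed T)\<close>, since an address belongs to the tree in which it was
  computed. Hence the work is done for an arbitrary tree with \<open>distinct (names T)\<close>, a
  condition kept by mirroring because that only permutes the list, and the statistics are shown to
  survive injective renamings that keep labels.

  The constants match through two shifts by one. A last child lies one level below its parent
  \<open>v\<close> and has \<open>deg T v - 1\<close> elder siblings; the level of a non-root node
  exceeds by one its sum of elder siblings in the mirrored tree. For \<open>v\<close> and its last
  child the shifts cancel: this is why \<open>lsw\<close> adds the degree to the sum of elder
  siblings.\<close>

primrec names :: "'a ptree \<Rightarrow> 'a list" where
  "names (PNode x ts) = x # concat (map names ts)"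

lemma set_names [simp]: "set (names T) = nodes T"
  by (induction T) auto

lemma names_relabel: "names (relabel f T) = map f (names T)"
  by (induction T) (simp add: map_concat comp_def cong: map_cong)

lemma proot_in_nodes [simp]: "proot T \<in> nodes T"
  by (cases T) simp

lemma subptrees_refl [simp]: "T \<in> subptrees T"
  by (cases T) simp

lemma subptrees_branch:
  "t \<in> subptrees T \<Longrightarrow> b \<in> set (branches t) \<Longrightarrow> b \<in> subptrees T"
proof (induction T)
  case (PNode x ts)
  then show ?case
    using subptrees_refl[of b] by (cases "t = PNode x ts") (auto simp del: subptrees_refl)
qed

lemma subptrees_nonroot_cases:
  assumes "t \<in> subptrees T" "t \<noteq> T"
  obtains i where "i < length (branches T)" "t \<in> subptrees (branches T ! i)"
  using assms by (cases T) (auto simp: in_set_conv_nth)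

lemma proot_in_nodes_subptree: "t \<in> subptrees T \<Longrightarrow> proot t \<in> nodes T"
  by (metis imageI proot_image_subptrees)

lemma nodes_obtain_subptree:
  assumes "v \<in> nodes T"
  obtains t where "t \<in> subptrees T" "proot t = v"
  using assms proot_image_subptrees[of T] by (metis imageE)

lemma distinct_concat_nth_disjoint:
  assumes "distinct (concat xss)" "i < length xss" "j < length xss" "i \<noteq> j"
  shows "set (xss ! i) \<inter> set (xss ! j) = {}"
  using assms
proof (induction xss arbitrary: i j)
  case (Cons xs xss)
  then have disj: "set xs \<inter> set (xss ! k) = {}" "set (xss ! k) \<inter> set xs = {}"
    if "k < length xss" for k
    using that by (auto simp: disjoint_iff)
  show ?case
    using Cons.prems Cons.IH disj by (cases i; cases j) auto
qed simp

lemma distinct_names_branch: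
  "distinct (names T) \<Longrightarrow> b \<in> set (branches T) \<Longrightarrow> distinct (names b)"
  by (cases T) (auto simp: distinct_concat_iff)

lemma distinct_names_disjoint:
  assumes "distinct (names T)" "i < length (branches T)" "j < length (branches T)"
    "v \<in> nodes (branches T ! i)" "v \<in> nodes (branches T ! j)"
  shows "i = j"
proof (rule ccontr)
  assume "i \<noteq> j"
  moreover have "distinct (concat (map names (branches T)))"
    using assms(1) by (cases T) simp
  ultimately show False
    using distinct_concat_nth_disjoint[of "map names (branches T)" i j] assms by auto
qed

lemma distinct_names_root:
  "distinct (names T) \<Longrightarrow> b \<in> set (branches T) \<Longrightarrow> proot T \<notin> nodes b"
  by (cases T) auto

lemma inj_on_proot_subptrees:
  "distinct (names T) \<Longrightarrow> inj_on proot (subptrees T)"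
proof (induction T)
  case (PNode x ts)
  let ?T = "PNode x ts"
  have *: "t = ?T" if t: "t \<in> subptrees ?T" "proot t = x" for t
  proof (rule ccontr)
    assume "t \<noteq> ?T"
    with t obtain i where "i < length ts" "t \<in> subptrees (ts ! i)"
      by (metis ptree.sel(2) subptrees_nonroot_cases)
    then show False
      using t(2) distinct_names_root[OF PNode.prems, of "ts ! i"] proot_in_nodes_subptree
      by fastforce
  qed
  show ?case
  proof (rule inj_onI)
    fix s t assume st: "s \<in> subptrees ?T" "t \<in> subptrees ?T" and eq: "proot s = proot t"
    show "s = t"
    proof (cases "proot s = x")
      case True
      then show ?thesis using *[of s] *[of t] st eq by simp
    next
      case False
      then have "s \<noteq> ?T" "t \<noteq> ?T" using eq by auto
      then obtain i j where ij: "i < length ts" "s \<in> subptrees (ts ! i)"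
          "j < length ts" "t \<in> subptrees (ts ! j)"
        using st by (metis ptree.sel(2) subptrees_nonroot_cases)
      then have "i = j"
        using distinct_names_disjoint[OF PNode.prems, of i j "proot s"]
          proot_in_nodes_subptree eq by fastforce
      moreover have "ts ! i \<in> set ts" using ij by simp
      ultimately show ?thesis
        using PNode.IH[of "ts ! i"] distinct_names_branch[OF PNode.prems, of "ts ! i"] ij eq
        by (auto dest: inj_onD)
    qed
  qed
qed

text \<open>Distinct names give each node exactly one subtree, so the definite description in
  \<open>kids\<close> can be evaluated.\<close>

lemma kids_subptree:
  assumes "distinct (names T)" "t \<in> subptrees T"
  shows "kids T (proot t) = map proot (branches t)"
proof -
  have "(THE s. s \<in> subptrees T \<and> proot s = proot t) = t"
    using assms inj_on_proot_subptrees by (intro the_equality) (auto dest: inj_onD)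
  then show ?thesis by (simp add: kids_def)
qed

lemma root_not_branch:
  assumes "distinct (names T)" "s \<in> subptrees T" "b \<in> set (branches s)"
  shows "proot b \<noteq> proot T"
proof (cases "s = T")
  case True
  then show ?thesis using assms distinct_names_root by (metis proot_in_nodes)
next
  case False
  then obtain m where m: "m < length (branches T)" "s \<in> subptrees (branches T ! m)"
    using assms(2) by (metis subptrees_nonroot_cases)
  then have "proot b \<in> nodes (branches T ! m)"
    using assms(3) by (meson proot_in_nodes_subptree subptrees_branch)
  then show ?thesis
    using distinct_names_root[OF assms(1), of "branches T ! m"] m(1) by auto
qed

text \<open>This makes parents, elder siblings and root paths well defined. Branches share no names,
  so two positions with the same name below the top lie in the same branch, where induction
  applies.\<close>

lemma branch_position_unique:
  assumes "distinct (names T)" "s \<in> subptrees T" "t \<in> subptrees T"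
    "i < length (branches s)" "j < length (branches t)"
    "proot (branches s ! i) = proot (branches t ! j)"
  shows "s = t \<and> i = j"
  using assms
proof (induction T)
  case (PNode x ts)
  let ?T = "PNode x ts"
  note d = PNode.prems(1)
  \<comment> \<open>A child of the root is not also a child of a deeper node: disjointness puts both
    into one branch, and the root of that branch is nobody's child inside it.\<close>
  have top: False
    if k: "k < length ts" "proot (ts ! k) = proot (branches r ! l)"
      and r: "r \<in> subptrees ?T" "r \<noteq> ?T" "l < length (branches r)" for k l r
  proof -
    obtain m where m: "m < length ts" "r \<in> subptrees (ts ! m)"
      using r by (metis ptree.sel(2) subptrees_nonroot_cases)
    then have "proot (ts ! k) \<in> nodes (ts ! m)"
      using k r(3) by (metis nth_mem proot_in_nodes_subptree subptrees_branch)
    then have "k = m"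
      using distinct_names_disjoint[OF d, of k m "proot (ts ! k)"] k(1) m(1) by simp
    moreover have "distinct (names (ts ! m))"
      using distinct_names_branch[OF d] m(1) by simp
    ultimately show False
      using root_not_branch[of "ts ! m" r "branches r ! l"] m k r by simp
  qed
  show ?case
  proof (cases "s = ?T \<or> t = ?T")
    case True
    then have "s = ?T \<and> t = ?T"
      using top[of i t j] top[of j s i] PNode.prems(2-6) by (metis ptree.sel(2))
    then show ?thesis
      using PNode.prems(4-6) distinct_names_disjoint[OF d, of i j "proot (ts ! i)"]
        proot_in_nodes[of "ts ! i"] proot_in_nodes[of "ts ! j"] by simp
  next
    case False
    then obtain k m where km: "k < length ts" "s \<in> subptrees (ts ! k)"
        "m < length ts" "t \<in> subptrees (ts ! m)"
      using PNode.prems by (metis ptree.sel(2) subptrees_nonroot_cases)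
    then have "proot (branches s ! i) \<in> nodes (ts ! k)" "proot (branches s ! i) \<in> nodes (ts ! m)"
      using PNode.prems(4-6) by (metis nth_mem proot_in_nodes_subptree subptrees_branch)+
    then have "k = m"
      using distinct_names_disjoint[OF d, of k m] km by simp
    then show ?thesis
      using PNode.IH[of "ts ! k"] distinct_names_branch[OF d, of "ts ! k"] km PNode.prems by simp
  qed
qed

section \<open>Recursive description of the node statistics\<close>

lemma kid_in_nodes:
  assumes "distinct (names T)" "u \<in> nodes T" "v \<in> set (kids T u)"
  shows "v \<in> nodes T"
proof -
  obtain t where t: "t \<in> subptrees T" "proot t = u"
    using assms(2) by (rule nodes_obtain_subptree)
  with assms show ?thesis
    using kids_subptree[OF assms(1) t(1)]
    by (auto intro: proot_in_nodes_subptree subptrees_branch)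
qed

lemma kids_position_unique:
  assumes "distinct (names T)" "u \<in> nodes T" "u' \<in> nodes T"
    "i < length (kids T u)" "j < length (kids T u')" "kids T u ! i = kids T u' ! j"
  shows "u = u' \<and> i = j"
proof -
  obtain s t where "s \<in> subptrees T" "proot s = u" "t \<in> subptrees T" "proot t = u'"
    using assms(2,3) by (metis nodes_obtain_subptree)
  then show ?thesis
    using branch_position_unique[OF assms(1), of s t i j] kids_subptree[OF assms(1), of s]
      kids_subptree[OF assms(1), of t] assms(4-6) by auto
qed

lemma root_not_kid:
  assumes "distinct (names T)" "u \<in> nodes T"
  shows "proot T \<notin> set (kids T u)"
proof -
  obtain t where t: "t \<in> subptrees T" "proot t = u"
    using assms(2) by (rule nodes_obtain_subptree)
  then show ?thesis
    using kids_subptree[OF assms(1) t(1)] root_not_branch[OF assms(1) t(1)] by fastforce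
qed

text \<open>Induction downwards along the edges, phrased with \<open>kids\<close> so that later
  arguments can avoid subtrees.\<close>

lemma nodes_kids_induct [consumes 2, case_names root kid]:
  assumes "distinct (names T)" "v \<in> nodes T"
    and root: "P (proot T)"
    and kid: "\<And>u i. u \<in> nodes T \<Longrightarrow> i < length (kids T u) \<Longrightarrow> P u \<Longrightarrow> P (kids T u ! i)"
  shows "P v"
proof -
  \<comment> \<open>Structural induction runs upwards while \<open>kid\<close> passes
    \<open>P\<close> downwards, so \<open>P\<close> at the root of \<open>t\<close> becomes a
    premise.\<close>
  have *: "\<forall>v\<in>nodes t. P v" if "t \<in> subptrees T" "P (proot t)" for t
    using that
  proof (induction t)
    case (PNode x ts)
    have "P (proot b) \<and> b \<in> subptrees T" if b: "b \<in> set ts" for b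
    proof -
      obtain i where i: "i < length ts" "b = ts ! i"
        using b by (metis in_set_conv_nth)
      show ?thesis
        using kid[of x i] kids_subptree[OF assms(1) PNode.prems(1)]
          proot_in_nodes_subptree[OF PNode.prems(1)] i PNode.prems
          subptrees_branch[OF PNode.prems(1)] by simp
    qed
    then show ?case using PNode by auto
  qed
  show ?thesis
    using *[of T] root assms(2) by simp
qed

lemma nodes_root_or_kid:
  assumes "distinct (names T)" "v \<in> nodes T" "v \<noteq> proot T"
  obtains u i where "u \<in> nodes T" "i < length (kids T u)" "v = kids T u ! i"
proof -
  have "v = proot T \<or> (\<exists>u\<in>nodes T. \<exists>i<length (kids T u). v = kids T u ! i)"
    using assms(1,2) by (induction rule: nodes_kids_induct) auto
  then show ?thesis using assms(3) that by blast
qed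

section \<open>Parents, elder siblings and root paths in terms of positions among children\<close>

lemma parent_kid:
  assumes "distinct (names T)" "u \<in> nodes T" "i < length (kids T u)"
  shows "parent T (kids T u ! i) = u"
  unfolding parent_def
proof (rule the_equality)
  show "u' = u" if "u' \<in> nodes T \<and> kids T u ! i \<in> set (kids T u')" for u'
    using that kids_position_unique[OF assms(1,2) _ assms(3), of u'] by (metis in_set_conv_nth)
qed (use assms in auto)

lemma elder_siblings_root:
  assumes "distinct (names T)"
  shows "elder_siblings T (proot T) = {}"
  using root_not_kid[OF assms] by (auto simp: elder_siblings_def) (metis nth_mem)

lemma elder_siblings_kid:
  assumes "distinct (names T)" "u \<in> nodes T" "i < length (kids T u)"
  shows "elder_siblings T (kids T u ! i) = (!) (kids T u) ` {..<i}"
proof (intro equalityI subsetI)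
  fix w assume "w \<in> elder_siblings T (kids T u ! i)"
  then obtain u' k j where "u' \<in> nodes T" "k < j" "j < length (kids T u')"
      "w = kids T u' ! k" "kids T u ! i = kids T u' ! j"
    by (auto simp: elder_siblings_def)
  moreover from this have "u' = u" "j = i"
    using kids_position_unique[OF assms(1), of u u' i j] assms(2,3) by auto
  ultimately show "w \<in> (!) (kids T u) ` {..<i}" by blast
next
  fix w assume "w \<in> (!) (kids T u) ` {..<i}"
  then show "w \<in> elder_siblings T (kids T u ! i)"
    using assms by (auto simp: elder_siblings_def)
qed

lemma card_elder_siblings_kid:
  assumes "distinct (names T)" "u \<in> nodes T" "i < length (kids T u)"
  shows "card (elder_siblings T (kids T u ! i)) = i"
  unfolding elder_siblings_kid[OF assms]
  using kids_position_unique[OF assms(1,2,2)] assms(3)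
  by (subst card_image) (auto simp: inj_on_def)

text \<open>The body of the definite description in \<open>root_path\<close>, kept as a predicate
  until unique existence is proved.\<close>

definition path_to_root :: "'v ptree \<Rightarrow> 'v \<Rightarrow> 'v list \<Rightarrow> bool" where
  "path_to_root T v xs \<longleftrightarrow> xs \<noteq> [] \<and> set xs \<subseteq> nodes T \<and> hd xs = v \<and> last xs = proot T \<and>
     successively (\<lambda>x y. x \<in> set (kids T y)) xs"

text \<open>The second entry of a path from \<open>v\<close> has \<open>v\<close> as a child, so
  uniqueness of positions forces it to be \<open>u\<close>. Unique existence thus passes from
  \<open>u\<close> to \<open>v\<close>.\<close>

lemma path_to_root_Cons:
  assumes "distinct (names T)" "u \<in> nodes T" "v \<in> set (kids T u)"
  shows "path_to_root T v xs \<longleftrightarrow> (\<exists>ys. xs = v # ys \<and> path_to_root T u ys)"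
proof
  assume p: "path_to_root T v xs"
  have "v \<noteq> proot T" using root_not_kid[OF assms(1,2)] assms(3) by auto
  \<comment> \<open>\<open>remdups_adj.cases\<close> merely splits lists into empty, singleton and
    longer ones; a singleton would make \<open>v\<close> the root.\<close>
  with p obtain w zs where xs: "xs = v # w # zs"
    unfolding path_to_root_def by (cases xs rule: remdups_adj.cases) auto
  with p have "w \<in> nodes T" "v \<in> set (kids T w)"
    by (auto simp: path_to_root_def)
  then have "w = u"
    using assms kids_position_unique[OF assms(1), of w u] by (metis in_set_conv_nth)
  then show "\<exists>ys. xs = v # ys \<and> path_to_root T u ys"
    using p xs by (auto simp: path_to_root_def)
next
  assume "\<exists>ys. xs = v # ys \<and> path_to_root T u ys"
  then obtain ys where ys: "xs = v # ys" "path_to_root T u ys" by blast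
  then obtain zs where "ys = u # zs"
    by (cases ys) (auto simp: path_to_root_def)
  then show "path_to_root T v xs"
    using ys assms kid_in_nodes by (auto simp: path_to_root_def)
qed

lemma path_to_root_root:
  assumes "distinct (names T)"
  shows "path_to_root T (proot T) xs \<longleftrightarrow> xs = [proot T]"
proof
  assume p: "path_to_root T (proot T) xs"
  show "xs = [proot T]"
  proof (cases xs rule: remdups_adj.cases)
    case (3 x y zs)
    then have "y \<in> nodes T" "proot T \<in> set (kids T y)"
      using p by (auto simp: path_to_root_def)
    then show ?thesis using root_not_kid[OF assms] by blast
  qed (use p in \<open>auto simp: path_to_root_def\<close>)
qed (auto simp: path_to_root_def)

lemma path_to_root_root_path:
  assumes "distinct (names T)" "v \<in> nodes T"
  shows "path_to_root T v xs \<longleftrightarrow> xs = root_path T v"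
proof -
  have rp: "root_path T v = (THE xs. path_to_root T v xs)" for v
    by (simp add: root_path_def path_to_root_def)
  have "\<exists>!xs. path_to_root T v xs"
    using assms
  proof (induction rule: nodes_kids_induct)
    case root
    then show ?case by (simp add: path_to_root_root[OF assms(1)])
  next
    case (kid u i)
    have v: "kids T u ! i \<in> set (kids T u)"
      using kid by simp
    show ?case
      unfolding path_to_root_Cons[OF assms(1) kid(1) v] using kid(3) by blast
  qed
  then show ?thesis
    unfolding rp by (metis (mono_tags, lifting) theI')
qed

lemma root_path_root:
  assumes "distinct (names T)"
  shows "root_path T (proot T) = [proot T]"
  using path_to_root_root_path[OF assms, of "proot T"] path_to_root_root[OF assms] by simp

lemma root_path_kid:
  assumes "distinct (names T)" "u \<in> nodes T" "i < length (kids T u)"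
  shows "root_path T (kids T u ! i) = kids T u ! i # root_path T u"
proof -
  have v: "kids T u ! i \<in> set (kids T u)" using assms by simp
  then have "path_to_root T (kids T u ! i) (kids T u ! i # root_path T u)"
    unfolding path_to_root_Cons[OF assms(1,2) v]
    using path_to_root_root_path[OF assms(1,2)] by blast
  then show ?thesis
    using path_to_root_root_path[OF assms(1) kid_in_nodes[OF assms(1,2) v]] by simp
qed

lemma root_path_hd:
  assumes "distinct (names T)" "u \<in> nodes T"
  obtains xs where "root_path T u = u # xs"
  using path_to_root_root_path[OF assms, of "root_path T u"]
  by (cases "root_path T u") (auto simp: path_to_root_def)

text \<open>Split off from \<open>lsw\<close> because it changes by a known amount along each edge,
  whereas the degree does not.\<close>

definition elder_sum :: "'v ptree \<Rightarrow> 'v \<Rightarrow> nat" where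
  "elder_sum T v = (\<Sum>w\<leftarrow>root_path T v. card (elder_siblings T w))"

lemma lsw_elder_sum: "lsw T v = deg T v + elder_sum T v"
  by (simp add: lsw_def elder_sum_def)

text \<open>\<open>deg_tilde\<close> without its value 0 at internal nodes: that exception would
  break the recursion along edges.\<close>

definition first_run :: "'v ptree \<Rightarrow> 'v \<Rightarrow> nat" where
  "first_run T v =
     (if \<forall>w\<in>set (root_path T v). elder_siblings T w = {} then lev T v
      else length (takeWhile (\<lambda>w. elder_siblings T w = {}) (root_path T v)) + 1)"

lemma deg_tilde_first_run: "deg_tilde T v = (if kids T v \<noteq> [] then 0 else first_run T v)"
  by (simp add: deg_tilde_def first_run_def)

section \<open>Level, elder sums and first runs along one edge\<close>

context
  fixes T :: "'v ptree"
  assumes d: "distinct (names T)"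
begin

lemma lev_root: "lev T (proot T) = 0"
  by (simp add: lev_def root_path_root[OF d])

lemma elder_sum_root: "elder_sum T (proot T) = 0"
  by (simp add: elder_sum_def root_path_root[OF d] elder_siblings_root[OF d])

lemma first_run_root: "first_run T (proot T) = 0"
  by (simp add: first_run_def root_path_root[OF d] elder_siblings_root[OF d] lev_root)

lemma lev_kid:
  assumes "u \<in> nodes T" "i < length (kids T u)"
  shows "lev T (kids T u ! i) = lev T u + 1"
proof -
  obtain xs where "root_path T u = u # xs"
    using d assms(1) by (rule root_path_hd)
  then show ?thesis by (simp add: lev_def root_path_kid[OF d assms])
qed

lemma elder_sum_kid:
  assumes "u \<in> nodes T" "i < length (kids T u)"
  shows "elder_sum T (kids T u ! i) = elder_sum T u + i"
  by (simp add: elder_sum_def root_path_kid[OF d assms] card_elder_siblings_kid[OF d assms])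

text \<open>A first child prolongs the run of its parent; any other child has an elder sibling and
  ends the run at itself. If no node of the path has elder siblings, the value is the level, which
  grows by one as well.\<close>

lemma first_run_kid:
  assumes "u \<in> nodes T" "i < length (kids T u)"
  shows "first_run T (kids T u ! i) = (if i = 0 then first_run T u + 1 else 1)"
  using root_path_kid[OF d assms] elder_siblings_kid[OF d assms] lev_kid[OF assms]
  by (cases "i = 0") (auto simp: first_run_def)

end

section \<open>The binary tree and its mirror image\<close>

lemma preorder_forest_to_bin: "preorder (forest_to_bin ts) = concat (map names ts)"
  by (induction ts rule: forest_to_bin.induct) auto

lemma names_phi: "names T = proot T # preorder (phi T)"
  by (cases T) (simp add: phi_def preorder_forest_to_bin)

lemma nodes_phi: "nodes T = insert (proot T) (set_tree (phi T))"
  using arg_cong[OF names_phi, of set T] by simp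

lemma distinct_names_iff:
  "distinct (names T) \<longleftrightarrow> proot T \<notin> set_tree (phi T) \<and> distinct (preorder (phi T))"
  by (simp add: names_phi)

lemma proot_phi_tilde [simp]: "proot (phi_tilde T) = proot T"
  by (simp add: phi_tilde_def phi_inv_def)

lemma phi_tilde_phi_tilde [simp]: "phi_tilde (phi_tilde T) = T"
  by (simp add: phi_tilde_def[of "phi_tilde T"] phi_phi_tilde phi_inv_phi)

lemma mset_preorder_mirror: "mset (preorder (mirror B)) = mset (preorder B)"
  by (induction B) auto

lemma set_tree_mirror: "set_tree (mirror B) = set_tree B"
  by (induction B) auto

lemma distinct_names_phi_tilde:
  assumes "distinct (names T)"
  shows "distinct (names (phi_tilde T))"
  using assms mset_eq_imp_distinct_iff[OF mset_preorder_mirror, of "phi T"]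
  by (simp add: distinct_names_iff phi_phi_tilde set_tree_mirror)

lemma left_child_mirror: "left_child (mirror B) x y \<longleftrightarrow> right_child B x y"
proof (induction B)
  case (Node l z r)
  then show ?case by (cases r) (auto simp: left_child_Node right_child_Node)
qed (simp add: left_child_def right_child_def)

lemma right_child_mirror: "right_child (mirror B) x y \<longleftrightarrow> left_child B x y"
  using left_child_mirror[of "mirror B" x y] by simp

text \<open>Induction from the root of \<open>B\<close> downwards, phrased with the child relations
  because these can be read both in \<open>T\<close> and in \<open>phi_tilde T\<close>.\<close>

lemma set_tree_child_induct [consumes 1, case_names root left right]:
  assumes "v \<in> set_tree B"
    and "\<And>l x r. B = Node l x r \<Longrightarrow> P x"
    and "\<And>x y. left_child B x y \<Longrightarrow> P x \<Longrightarrow> P y"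
    and "\<And>x y. right_child B x y \<Longrightarrow> P x \<Longrightarrow> P y"
  shows "P v"
  using assms
proof (induction B)
  case (Node l x r)
  have x: "P x" using Node.prems(2) by blast
  consider "v = x" | "v \<in> set_tree l" | "v \<in> set_tree r"
    using Node.prems(1) by auto
  then show ?case
  proof cases
    case 2
    show ?thesis
    proof (rule Node.IH(1)[OF 2])
      \<comment> \<open>The root of \<open>l\<close> is the left child of \<open>x\<close>, so the
        base case for \<open>l\<close> comes from the step \<open>left\<close>.\<close>
      show "P y" if "l = Node l' y r'" for l' y r'
        using Node.prems(3)[of x y] x that by (simp add: left_child_Node)
      show "P y'" if "left_child l y y'" "P y" for y y'
        using Node.prems(3)[of y y'] that by (simp add: left_child_Node)
      show "P y'" if "right_child l y y'" "P y" for y y'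
        using Node.prems(4)[of y y'] that by (simp add: right_child_Node)
    qed
  next
    case 3
    show ?thesis
    proof (rule Node.IH(2)[OF 3])
      show "P y" if "r = Node l' y r'" for l' y r'
        using Node.prems(4)[of x y] x that by (simp add: right_child_Node)
      show "P y'" if "left_child r y y'" "P y" for y y'
        using Node.prems(3)[of y y'] that by (simp add: left_child_Node)
      show "P y'" if "right_child r y y'" "P y" for y y'
        using Node.prems(4)[of y y'] that by (simp add: right_child_Node)
    qed
  qed (simp add: x)
qed simp

lemma subtrees_root_unique:
  assumes "distinct (preorder B)" "Node l v r \<in> subtrees B" "Node l' v r' \<in> subtrees B"
  shows "l = l' \<and> r = r'"
  using assms
proof (induction B)
  case (Node a x b)
  have dis: "x \<notin> set_tree a" "x \<notin> set_tree b" "set_tree a \<inter> set_tree b = {}"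
      "distinct (preorder a)" "distinct (preorder b)"
    using Node.prems(1) by auto
  have mem: "Node l v r \<in> subtrees t \<Longrightarrow> v \<in> set_tree t"
      "Node l' v r' \<in> subtrees t \<Longrightarrow> v \<in> set_tree t" for t
    by (auto intro: in_set_tree_if)
  have sub: "Node l v r = Node a x b \<or> Node l v r \<in> subtrees a \<or> Node l v r \<in> subtrees b"
      "Node l' v r' = Node a x b \<or> Node l' v r' \<in> subtrees a \<or> Node l' v r' \<in> subtrees b"
    using Node.prems(2,3) unfolding subtrees.simps by blast+
  have "v \<in> set_tree (Node a x b)"
    using Node.prems(2) by (rule in_set_tree_if)
  then consider "v = x" | "v \<in> set_tree a" | "v \<in> set_tree b" by auto
  then show ?case
  proof cases
    case 1
    then have "v \<notin> set_tree a" "v \<notin> set_tree b" using dis by auto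
    then have "Node l v r = Node a x b" "Node l' v r' = Node a x b"
      using sub mem by blast+
    then show ?thesis by simp
  next
    case 2
    then have "v \<noteq> x" "v \<notin> set_tree b" using dis by auto
    then have "Node l v r \<in> subtrees a" "Node l' v r' \<in> subtrees a"
      using sub mem by blast+
    then show ?thesis by (rule Node.IH(1)[OF dis(4)])
  next
    case 3
    then have "v \<noteq> x" "v \<notin> set_tree a" using dis by auto
    then have "Node l v r \<in> subtrees b" "Node l' v r' \<in> subtrees b"
      using sub mem by blast+
    then show ?thesis by (rule Node.IH(2)[OF dis(5)])
  qed
qed simp

text \<open>\<open>complete_bin\<close> tests for an empty right subtree, while the translation to
  \<open>T\<close> uses \<open>right_child\<close>. The two agree because distinct names exclude a
  second occurrence of \<open>v\<close> that has a right child.\<close>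

lemma no_right_child_iff:
  assumes "distinct (preorder B)"
  shows "(\<exists>l. Node l v Leaf \<in> subtrees B) \<longleftrightarrow> v \<in> set_tree B \<and> (\<nexists>y. right_child B v y)"
proof
  assume "\<exists>l. Node l v Leaf \<in> subtrees B"
  then obtain l where l: "Node l v Leaf \<in> subtrees B" ..
  have False if y: "right_child B v y" for y
  proof -
    obtain l' a b where "Node l' v (Node a y b) \<in> subtrees B"
      using y unfolding right_child_def by blast
    then show False using subtrees_root_unique[OF assms l] by blast
  qed
  then show "v \<in> set_tree B \<and> (\<nexists>y. right_child B v y)"
    using l in_set_tree_if by metis
next
  assume v: "v \<in> set_tree B \<and> (\<nexists>y. right_child B v y)"
  then obtain l r where "Node l v r \<in> subtrees B"
    by (meson set_treeE)
  moreover from this v have "r = Leaf"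
    unfolding right_child_def by (cases r) blast+
  ultimately show "\<exists>l. Node l v Leaf \<in> subtrees B" by blast
qed

section \<open>Steps of the binary tree in terms of \<open>kids\<close>\<close>

context
  fixes T :: "'v ptree"
  assumes d: "distinct (names T)"
begin

lemma in_set_tree_phi: "v \<in> set_tree (phi T) \<longleftrightarrow> v \<in> nodes T \<and> v \<noteq> proot T"
  using d by (auto simp: nodes_phi distinct_names_iff)

lemma kid_in_set_tree_phi:
  assumes "u \<in> nodes T" "i < length (kids T u)"
  shows "kids T u ! i \<in> set_tree (phi T)"
  using assms root_not_kid[OF d assms(1)] kid_in_nodes[OF d assms(1)]
  by (metis in_set_tree_phi nth_mem)

lemma phi_root_kid:
  assumes "phi T = Node l x r"
  shows "0 < length (kids T (proot T)) \<and> kids T (proot T) ! 0 = x"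
proof -
  have "forest_to_bin (branches T) = Node l x r"
    using assms by (simp add: phi_def)
  then show ?thesis
    using kids_subptree[OF d, of T]
    by (cases "branches T" rule: forest_to_bin.cases) auto
qed

text \<open>The root of \<open>T\<close> is excluded, being no node of \<open>phi T\<close>. For
  right steps it may occur as the common parent \<open>u\<close>, which is not an end of the
  step.\<close>

lemma left_child_phi_kids:
  "left_child (phi T) x y \<longleftrightarrow>
     x \<in> nodes T \<and> x \<noteq> proot T \<and> 0 < length (kids T x) \<and> y = kids T x ! 0"
proof
  assume "left_child (phi T) x y"
  then obtain b t bs where t: "b \<in> set (branches T)" "t \<in> subptrees b" "proot t = x"
      "map proot (branches t) = y # bs"
    unfolding left_child_phi by metis
  then have "t \<in> subptrees T" by (cases T) auto
  moreover have "x \<noteq> proot T"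
    using t distinct_names_root[OF d t(1)] proot_in_nodes_subptree[OF t(2)] by auto
  ultimately show "x \<in> nodes T \<and> x \<noteq> proot T \<and> 0 < length (kids T x) \<and> y = kids T x ! 0"
    using t kids_subptree[OF d, of t] proot_in_nodes_subptree[of t T] by auto
next
  assume r: "x \<in> nodes T \<and> x \<noteq> proot T \<and> 0 < length (kids T x) \<and> y = kids T x ! 0"
  then obtain t where t: "t \<in> subptrees T" "proot t = x"
    by (meson nodes_obtain_subptree)
  with r obtain i where "i < length (branches T)" "t \<in> subptrees (branches T ! i)"
    by (metis subptrees_nonroot_cases)
  moreover have "map proot (branches t) = y # tl (map proot (branches t))"
    using r kids_subptree[OF d t(1)] t(2) by (cases "branches t") auto
  ultimately show "left_child (phi T) x y"
    unfolding left_child_phi using t(2) by (metis nth_mem)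
qed

lemma right_child_phi_kids:
  "right_child (phi T) x y \<longleftrightarrow>
     (\<exists>u\<in>nodes T. \<exists>i. Suc i < length (kids T u) \<and> x = kids T u ! i \<and> y = kids T u ! Suc i)"
proof -
  have *: "(\<exists>as bs. zs = as @ x # y # bs) \<longleftrightarrow>
      (\<exists>i. Suc i < length zs \<and> x = zs ! i \<and> y = zs ! Suc i)" (is "?L \<longleftrightarrow> ?R") for zs :: "'v list"
  proof
    assume ?L
    then obtain as bs where "zs = as @ x # y # bs" by blast
    then have "Suc (length as) < length zs \<and> x = zs ! length as \<and> y = zs ! Suc (length as)"
      by (simp add: nth_append)
    then show ?R by blast
  next
    assume ?R
    then obtain i where "Suc i < length zs" "x = zs ! i" "y = zs ! Suc i" by blast
    then have "zs = take i zs @ x # y # drop (Suc (Suc i)) zs"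
      by (metis Cons_nth_drop_Suc Suc_lessD append_take_drop_id)
    then show ?L by blast
  qed
  have "right_child (phi T) x y \<longleftrightarrow>
      (\<exists>t\<in>subptrees T. \<exists>as bs. kids T (proot t) = as @ x # y # bs)"
    unfolding right_child_phi using kids_subptree[OF d] by simp
  also have "\<dots> \<longleftrightarrow> (\<exists>u\<in>nodes T. \<exists>as bs. kids T u = as @ x # y # bs)"
    unfolding proot_image_subptrees[symmetric] by blast
  finally show ?thesis unfolding * .
qed

lemma no_left_child_phi_iff:
  "v \<in> set_tree (phi T) \<and> (\<nexists>y. left_child (phi T) v y) \<longleftrightarrow>
     v \<in> nodes T \<and> v \<noteq> proot T \<and> kids T v = []"
  unfolding left_child_phi_kids in_set_tree_phi by auto

lemma no_right_child_phi_iff: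
  "v \<in> set_tree (phi T) \<and> (\<nexists>y. right_child (phi T) v y) \<longleftrightarrow>
     (\<exists>u\<in>nodes T. kids T u \<noteq> [] \<and> v = last (kids T u))"
proof
  assume v: "v \<in> set_tree (phi T) \<and> (\<nexists>y. right_child (phi T) v y)"
  then obtain u i where u: "u \<in> nodes T" "i < length (kids T u)" "v = kids T u ! i"
    using nodes_root_or_kid[OF d] in_set_tree_phi by metis
  then have "Suc i = length (kids T u)"
    using v unfolding right_child_phi_kids by (metis Suc_lessI)
  then have "kids T u \<noteq> [] \<and> v = last (kids T u)"
    using u by (metis diff_Suc_1 last_conv_nth length_0_conv nat.distinct(1))
  then show "\<exists>u\<in>nodes T. kids T u \<noteq> [] \<and> v = last (kids T u)"
    using u(1) by blast
next
  assume "\<exists>u\<in>nodes T. kids T u \<noteq> [] \<and> v = last (kids T u)"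
  then obtain u where u: "u \<in> nodes T" "kids T u \<noteq> []" "v = last (kids T u)" by blast
  define i where "i = length (kids T u) - 1"
  have i: "i < length (kids T u)" "v = kids T u ! i" "\<not> Suc i < length (kids T u)"
    using u by (auto simp: i_def last_conv_nth)
  have "\<not> right_child (phi T) v y" for y
  proof
    assume "right_child (phi T) v y"
    then obtain u' j where u': "u' \<in> nodes T" "Suc j < length (kids T u')" "v = kids T u' ! j"
      unfolding right_child_phi_kids by blast
    then have "u = u' \<and> i = j"
      using kids_position_unique[OF d u(1) u'(1) i(1), of j] i(2) by simp
    then show False using u'(2) i(3) by blast
  qed
  then show "v \<in> set_tree (phi T) \<and> (\<nexists>y. right_child (phi T) v y)"
    using kid_in_set_tree_phi[OF u(1) i(1)] i(2) by blast
qed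

lemma last_kid_obtain:
  assumes "u \<in> nodes T" "kids T u \<noteq> []"
  obtains i where "i < length (kids T u)" "last (kids T u) = kids T u ! i" "length (kids T u) = i + 1"
  using assms that[of "length (kids T u) - 1"] by (simp add: last_conv_nth)

lemma last_kid_inj:
  assumes "u \<in> nodes T" "kids T u \<noteq> []" "u' \<in> nodes T" "kids T u' \<noteq> []"
    "last (kids T u) = last (kids T u')"
  shows "u = u'"
  using assms kids_position_unique[OF d assms(1,3), of "length (kids T u) - 1" "length (kids T u') - 1"]
  by (simp add: last_conv_nth)

end

text \<open>Passing to the mirror image exchanges steps to a leftmost child with steps to the next
  sibling, so all three equations propagate along the edges of the binary tree.\<close>

lemma lev_elder_sum_phi_tilde:
  assumes d: "distinct (names T)" and "v \<in> set_tree (phi T)"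
  shows "lev T v = elder_sum (phi_tilde T) v + 1 \<and> lev (phi_tilde T) v = elder_sum T v + 1 \<and>
    first_run (phi_tilde T) v = card (elder_siblings T v) + 1"
  using assms(2)
proof (induction rule: set_tree_child_induct)
  note d' = distinct_names_phi_tilde[OF d]
  have phi': "phi (phi_tilde T) = mirror (phi T)" by (rule phi_phi_tilde)
  {
    case (root l x r)
    \<comment> \<open>The root of the binary tree is the first child of the root in both trees, with
      level 1, elder sum 0 and first run 1.\<close>
    then have "phi (phi_tilde T) = Node (mirror r) x (mirror l)"
      by (simp add: phi')
    from phi_root_kid[OF d root] phi_root_kid[OF d' this]
    show ?case
      using lev_kid[OF d, of "proot T" 0] lev_kid[OF d', of "proot T" 0]
        elder_sum_kid[OF d, of "proot T" 0] elder_sum_kid[OF d', of "proot T" 0]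
        first_run_kid[OF d', of "proot T" 0] card_elder_siblings_kid[OF d, of "proot T" 0]
      by (simp add: nodes_phi_tilde lev_root[OF d] lev_root[OF d', simplified]
          elder_sum_root[OF d] elder_sum_root[OF d', simplified] first_run_root[OF d', simplified])
  next
    case (left x y)
    then have x: "x \<in> nodes T" "0 < length (kids T x)" "y = kids T x ! 0"
      unfolding left_child_phi_kids[OF d] by auto
    \<comment> \<open>In \<open>T\<close>, \<open>y\<close> is the first child of \<open>x\<close>:
      the level grows by one and the elder sum stays. In the mirrored tree \<open>y\<close> is the
      next sibling: the level stays, the elder sum grows by one, and the first run is 1, matching
      the absence of elder siblings in \<open>T\<close>.\<close>
    have "right_child (phi (phi_tilde T)) x y"
      using left by (simp add: phi' right_child_mirror)
    then obtain u i where u: "u \<in> nodes (phi_tilde T)" "Suc i < length (kids (phi_tilde T) u)"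
        "x = kids (phi_tilde T) u ! i" "y = kids (phi_tilde T) u ! Suc i"
      unfolding right_child_phi_kids[OF d'] by blast
    show ?case
      using left.IH lev_kid[OF d x(1,2)] elder_sum_kid[OF d x(1,2)]
        card_elder_siblings_kid[OF d x(1,2)]
        lev_kid[OF d' u(1), of i] lev_kid[OF d' u(1,2)] elder_sum_kid[OF d' u(1), of i]
        elder_sum_kid[OF d' u(1,2)] first_run_kid[OF d' u(1,2)] x(3) u(2-4)
      by simp
  next
    case (right x y)
    then obtain u i where u: "u \<in> nodes T" "Suc i < length (kids T u)"
        "x = kids T u ! i" "y = kids T u ! Suc i"
      unfolding right_child_phi_kids[OF d] by blast
    \<comment> \<open>The roles are exchanged: \<open>y\<close> has one elder sibling more than
      \<open>x\<close> in \<open>T\<close>, and as a first child in the mirrored tree it prolongs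
      the run of \<open>x\<close> by one.\<close>
    have "left_child (phi (phi_tilde T)) x y"
      using right by (simp add: phi' left_child_mirror)
    then have x: "x \<in> nodes (phi_tilde T)" "0 < length (kids (phi_tilde T) x)"
        "y = kids (phi_tilde T) x ! 0"
      unfolding left_child_phi_kids[OF d'] by auto
    show ?case
      using right.IH lev_kid[OF d' x(1,2)] elder_sum_kid[OF d' x(1,2)] first_run_kid[OF d' x(1,2)]
        lev_kid[OF d u(1), of i] lev_kid[OF d u(1,2)] elder_sum_kid[OF d u(1), of i]
        elder_sum_kid[OF d u(1,2)] card_elder_siblings_kid[OF d u(1), of i]
        card_elder_siblings_kid[OF d u(1,2)] x(3) u(2-4)
      by simp
  }
qed

section \<open>The relation between the nodes\<close>

lemma right_child_complete_bin:
  "right_child (complete_bin par B) (Orig u) (Added v) \<longleftrightarrow>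
     (\<exists>l. Node l u Leaf \<in> subtrees B) \<and> v = par u"
proof (induction B)
  case (Node l x r)
  \<comment> \<open>A single added node has no right child, and neither has \<open>Leaf\<close>, so
    the two branches of the conditional agree.\<close>
  have *: "right_child (if t = Leaf then Node Leaf (Added w) Leaf else complete_bin par t) (Orig u) (Added v)
      \<longleftrightarrow> right_child (complete_bin par t) (Orig u) (Added v)" for t w
    by (auto simp: right_child_def)
  have **: "(\<exists>a b. (if r = Leaf then Node Leaf (Added w) Leaf else complete_bin par r) = Node a (Added v) b)
      \<longleftrightarrow> r = Leaf \<and> v = w" for w
    by (cases r) auto
  show ?case
    unfolding complete_bin.simps right_child_Node * ** Node.IH by auto
qed (simp add: right_child_def)

text \<open>The empty right slots of \<open>phi T\<close> belong to the last children, and the node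
  added in such a slot is named after the parent of that last child.\<close>

lemma right_child_complement_iff:
  assumes d: "distinct (names T)"
  shows "right_child (complement T) (Orig u) (Added v) \<longleftrightarrow>
     v \<in> nodes T \<and> kids T v \<noteq> [] \<and> u = last (kids T v)"
proof -
  have p: "parent T (last (kids T w)) = w" if "w \<in> nodes T" "kids T w \<noteq> []" for w
    using last_kid_obtain[OF d that] parent_kid[OF d that(1)] by metis
  have "right_child (complement T) (Orig u) (Added v) \<longleftrightarrow>
      (\<exists>w\<in>nodes T. kids T w \<noteq> [] \<and> u = last (kids T w)) \<and> v = parent T u"
    unfolding complement_def right_child_complete_bin
    using no_right_child_iff[of "phi T" u] no_right_child_phi_iff[OF d, of u] d
    by (simp add: distinct_names_iff)
  also have "\<dots> \<longleftrightarrow> v \<in> nodes T \<and> kids T v \<noteq> [] \<and> u = last (kids T v)"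
    using p by metis
  finally show ?thesis .
qed

section \<open>Symmetry, existence and uniqueness for the relation\<close>

lemma leads_to_sym: "leads_to (phi_tilde T) u v \<longleftrightarrow> leads_to T v u"
  by (auto simp: leads_to_def)

lemma leads_to_iff:
  assumes "distinct (names T)"
  shows "leads_to T v u \<longleftrightarrow>
     v \<in> nodes T \<and> kids T v \<noteq> [] \<and> u = last (kids T v) \<or>
     u \<in> nodes T \<and> kids (phi_tilde T) u \<noteq> [] \<and> v = last (kids (phi_tilde T) u)"
  unfolding leads_to_def right_child_complement_iff[OF assms]
    right_child_complement_iff[OF distinct_names_phi_tilde[OF assms]] nodes_phi_tilde ..

text \<open>A last child of \<open>T\<close> has no right child in \<open>phi T\<close>, hence no
  left child in the mirror image, hence no children in \<open>phi_tilde T\<close>; each step can be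
  reversed.\<close>

lemma last_kid_phi_tilde_iff:
  assumes d: "distinct (names T)"
  shows "(\<exists>v\<in>nodes T. kids T v \<noteq> [] \<and> u = last (kids T v)) \<longleftrightarrow>
    u \<in> nodes T \<and> u \<noteq> proot T \<and> kids (phi_tilde T) u = []"
  unfolding no_right_child_phi_iff[OF d, symmetric]
  using no_left_child_phi_iff[OF distinct_names_phi_tilde[OF d], of u] 
  by (simp add: phi_phi_tilde left_child_mirror nodes_phi_tilde set_tree_mirror)

lemma last_kid_tilde_phi_tilde_iff:
  assumes d: "distinct (names T)"
  shows "(\<exists>u\<in>nodes T. kids (phi_tilde T) u \<noteq> [] \<and> v = last (kids (phi_tilde T) u)) \<longleftrightarrow>
    v \<in> nodes T \<and> v \<noteq> proot T \<and> kids T v = []"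
  using last_kid_phi_tilde_iff[OF distinct_names_phi_tilde[OF d]] by (simp add: nodes_phi_tilde)

text \<open>The third claim makes the two alternatives of \<open>leads_to_iff\<close> exclude each
  other, on which uniqueness rests.\<close>

lemma leads_to_nodes:
  assumes "distinct (names T)" "leads_to T v u"
  shows "v \<in> nodes T" "u \<in> nodes T" "kids (phi_tilde T) u = [] \<longleftrightarrow> kids T v \<noteq> []"
  using assms(2) last_kid_phi_tilde_iff[OF assms(1), of u]
    last_kid_tilde_phi_tilde_iff[OF assms(1), of v]
  unfolding leads_to_iff[OF assms(1)] by blast+

lemma leads_to_unique:
  assumes d: "distinct (names T)" and "leads_to T v u" "leads_to T v u'"
  shows "u = u'"
  using assms(2,3) leads_to_nodes(3)[OF d assms(2)] leads_to_nodes(3)[OF d assms(3)]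
    last_kid_inj[OF distinct_names_phi_tilde[OF d], of u u']
  unfolding leads_to_iff[OF d] by (auto simp: nodes_phi_tilde)

text \<open>A lone root has no last child and is nobody's last child, so it leads nowhere. In any
  larger tree the root is internal, and every leaf is a last child in
  \<open>phi_tilde T\<close>.\<close>

lemma leads_to_total:
  assumes d: "distinct (names T)" and "nodes T \<noteq> {proot T}" "v \<in> nodes T"
  shows "\<exists>u. leads_to T v u"
proof (cases "kids T v = []")
  case True
  have "kids T (proot T) \<noteq> []"
    using assms(2) kids_subptree[OF d, of T] by (cases T) auto
  with True have "v \<noteq> proot T" by auto
  then show ?thesis
    unfolding leads_to_iff[OF d]
    using last_kid_tilde_phi_tilde_iff[OF d, of v] True assms(3) by blast
next
  case False
  then show ?thesis unfolding leads_to_iff[OF d] using assms(3) by blast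
qed

lemma lev_lsw_last_kid:
  assumes d: "distinct (names T)" and v: "v \<in> nodes T" "kids T v \<noteq> []"
    and u: "u = last (kids T v)"
  shows "lev T v = lsw (phi_tilde T) u" "lsw T v = lev (phi_tilde T) u"
    "deg T v = first_run (phi_tilde T) u"
proof -
  obtain i where i: "i < length (kids T v)" "u = kids T v ! i" "length (kids T v) = i + 1"
    using last_kid_obtain[OF d v] u by metis
  have "leads_to T v u"
    using v u by (simp add: leads_to_iff[OF d])
  \<comment> \<open>In \<open>phi_tilde T\<close> the node \<open>u\<close> is a leaf, so its
    \<open>lsw\<close> is the bare elder sum.\<close>
  then have "deg (phi_tilde T) u = 0"
    using leads_to_nodes(3)[OF d] v(2) by (auto simp: deg_def)
  then show "lev T v = lsw (phi_tilde T) u" "lsw T v = lev (phi_tilde T) u"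
    "deg T v = first_run (phi_tilde T) u"
    using lev_elder_sum_phi_tilde[OF d kid_in_set_tree_phi[OF d v(1) i(1)]]
      lev_kid[OF d v(1) i(1)] elder_sum_kid[OF d v(1) i(1)]
      card_elder_siblings_kid[OF d v(1) i(1)] i(2,3)
    by (simp_all add: lsw_elder_sum deg_def)
qed

lemma leads_to_statistics:
  assumes d: "distinct (names T)" and "leads_to T v u"
  shows "lev T v = lsw (phi_tilde T) u \<and> lsw T v = lev (phi_tilde T) u \<and>
    deg T v = deg_tilde (phi_tilde T) u"
proof (cases "kids T v = []")
  case False
  then have "v \<in> nodes T" "u = last (kids T v)" "kids (phi_tilde T) u = []"
    using assms(2) leads_to_nodes(1,3)[OF assms] unfolding leads_to_iff[OF d] by auto
  then show ?thesis
    using lev_lsw_last_kid[OF d _ False] by (simp add: deg_tilde_first_run)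
next
  case True
  \<comment> \<open>The leaf case is \<open>lev_lsw_last_kid\<close> for \<open>phi_tilde T\<close>,
    whose image under \<open>phi_tilde\<close> is \<open>T\<close>. The degree equation reads 0 = 0:
    \<open>v\<close> is a leaf of \<open>T\<close> and \<open>u\<close> is internal in
    \<open>phi_tilde T\<close>.\<close>
  then have "u \<in> nodes (phi_tilde T)" "kids (phi_tilde T) u \<noteq> []" "v = last (kids (phi_tilde T) u)"
    using assms(2) unfolding leads_to_iff[OF d] by (auto simp: nodes_phi_tilde)
  then show ?thesis
    using lev_lsw_last_kid[OF distinct_names_phi_tilde[OF d], of u v] True
    by (simp add: deg_tilde_def deg_def)
qed

text \<open>By \<open>leads_to_sym\<close>, surjectivity and injectivity are existence and
  uniqueness for \<open>phi_tilde T\<close>.\<close>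

lemma leads_to_bij:
  assumes d: "distinct (names T)" and ne: "nodes T \<noteq> {proot T}"
  obtains f where "bij_betw f (nodes T) (nodes T)" "\<And>v. v \<in> nodes T \<Longrightarrow> leads_to T v (f v)"
proof -
  note d' = distinct_names_phi_tilde[OF d]
  define f where "f v = (SOME u. leads_to T v u)" for v
  define g where "g u = (SOME v. leads_to T v u)" for u
  have f: "leads_to T v (f v)" if "v \<in> nodes T" for v
    unfolding f_def using leads_to_total[OF d ne that] by (rule someI_ex)
  have g: "leads_to T (g u) u" if "u \<in> nodes T" for u
  proof -
    have "\<exists>v. leads_to T v u"
      using leads_to_total[OF d', of u] ne that by (simp add: nodes_phi_tilde leads_to_sym)
    then show ?thesis unfolding g_def by (rule someI_ex)
  qed
  have inj: "v = v'" if "leads_to T v u" "leads_to T v' u" for v v' u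
    using leads_to_unique[OF d', of u v v'] that by (simp add: leads_to_sym)
  have "bij_betw f (nodes T) (nodes T)"
  proof (rule bij_betw_byWitness[where f' = g])
    show "\<forall>v\<in>nodes T. g (f v) = v"
      using f g inj leads_to_nodes(2)[OF d] by metis
    show "\<forall>u\<in>nodes T. f (g u) = u"
      using f g leads_to_unique[OF d] leads_to_nodes(1)[OF d] by metis
    show "f ` nodes T \<subseteq> nodes T" "g ` nodes T \<subseteq> nodes T"
      using f g leads_to_nodes(1,2)[OF d] by blast+
  qed
  then show ?thesis using f that by blast
qed

section \<open>Renaming the nodes\<close>

text \<open>The renaming \<open>f\<close> sends an address to the node of \<open>T\<close> found
  there. With \<open>g = snd\<close>, every named tree is a renaming of the addressed version of its
  label tree.\<close>

lemma relabel_addressed: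
  "\<exists>f. relabel f (addressed (relabel g T)) = T \<and> (\<forall>z\<in>nodes (addressed (relabel g T)). g (f z) = snd z)"
proof (induction T)
  case (PNode x ts)
  then obtain F where F: "relabel (F b) (addressed (relabel g b)) = b"
      "\<forall>z\<in>nodes (addressed (relabel g b)). g (F b z) = snd z" if "b \<in> set ts" for b
    by metis
  \<comment> \<open>The first entry of an address selects the branch, whose own renaming treats the
    remaining address.\<close>
  define f where "f = (\<lambda>(a, l). case a of [] \<Rightarrow> x | i # a' \<Rightarrow> F (ts ! i) (a', l))"
  have comp: "relabel f (relabel (\<lambda>(a, l). (i # a, l)) t) = relabel (F (ts ! i)) t" for i t
    by (auto simp: ptree.map_comp f_def comp_def case_prod_beta intro!: ptree.map_cong)
  have "relabel f (addressed (relabel g (PNode x ts))) = PNode x ts"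
    by (rule ptree.expand) (auto simp: f_def intro!: nth_equalityI, auto simp: f_def[symmetric] comp F)
  moreover have "g (f z) = snd z" if "z \<in> nodes (addressed (relabel g (PNode x ts)))" for z
    using that F(2) unfolding ptree.map nodes_addressed by (auto simp: f_def)
  ultimately show ?case by blast
qed

text \<open>Addresses from different branches differ in their first entry. The starting index
  \<open>m\<close> is general because it moves during the induction on the list.\<close>

lemma distinct_concat_map2_Cons:
  assumes "\<forall>t\<in>set ts. distinct (h t)"
  shows "distinct (concat (map2 (\<lambda>i t. map (\<lambda>(a, l). (i # a, l)) (h t)) [m..<m + length ts] ts))"
  using assms
proof (induction ts arbitrary: m)
  case (Cons t ts)
  have ran: "\<exists>i a l. v = (i # a, l) \<and> k \<le> i"
    if "v \<in> set (concat (map2 (\<lambda>i t. map (\<lambda>(a, l). (i # a, l)) (h t)) [k..<k + length ts] ts))"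
    for v k
    using that by (fastforce simp: set_zip)
  have "inj_on (\<lambda>(a, l). (m # a, l)) (set (h t))"
    by (auto simp: inj_on_def)
  moreover have "[m..<m + length (t # ts)] = m # [Suc m..<Suc m + length ts]"
    by (subst upt_conv_Cons) simp_all
  ultimately show ?case
    using Cons.IH[of "Suc m"] Cons.prems ran[of _ "Suc m"]
    by (fastforce simp: distinct_map simp del: upt_Suc)
qed simp

lemma names_addressed:
  "names (addressed (PNode x ts)) =
     ([], x) # concat (map2 (\<lambda>i t. map (\<lambda>(a, l). (i # a, l)) (names (addressed t))) [0..<length ts] ts)"
proof -
  have "map names (map2 (\<lambda>i. relabel (\<lambda>(a, l). (i # a, l))) [0..<length ts] (map addressed ts)) =
      map2 (\<lambda>i t. map (\<lambda>(a, l). (i # a, l)) (names (addressed t))) [0..<length ts] ts"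
    by (rule nth_equalityI) (auto simp: names_relabel)
  then show ?thesis by simp
qed

lemma distinct_names_addressed: "distinct (names (addressed T))"
proof (induction T)
  case (PNode x ts)
  have "([], x) \<notin> set (concat (map2 (\<lambda>i t. map (\<lambda>(a, l). (i # a, l)) (names (addressed t)))
      [0..<length ts] ts))"
    by (auto simp: set_zip)
  then show ?case
    using distinct_concat_map2_Cons[of ts "names \<circ> addressed" 0] PNode
    unfolding names_addressed by (simp add: comp_def)
qed

text \<open>The multiset statistics have this shape: \<open>P\<close> selects nodes and
  \<open>g\<close> records a label or a number. The conditions are confined to \<open>A\<close>
  because a renaming is controlled only on the nodes of a tree.\<close>

lemma image_mset_filter_reindex:
  assumes "inj_on f A" "\<And>v. v \<in> A \<Longrightarrow> P' (f v) \<longleftrightarrow> P v" "\<And>v. v \<in> A \<Longrightarrow> g' (f v) = g v"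
  shows "image_mset g' (mset_set {v \<in> f ` A. P' v}) = image_mset g (mset_set {v \<in> A. P v})"
proof (cases "finite {v \<in> A. P v}")
  case True
  have "{v \<in> f ` A. P' v} = f ` {v \<in> A. P v}"
    using assms(2) by auto
  moreover have "inj_on f {v \<in> A. P v}"
    using assms(1) by (rule inj_on_subset) auto
  ultimately have "mset_set {v \<in> f ` A. P' v} = image_mset f (mset_set {v \<in> A. P v})"
    by (simp add: image_mset_mset_set)
  then show ?thesis
    using assms(3) True by (auto simp: multiset.map_comp comp_def intro!: image_mset_cong)
next
  \<comment> \<open>\<open>mset_set\<close> of an infinite set is empty, and injectivity carries
    infiniteness over.\<close>
  case False
  have eq: "{v \<in> f ` A. P' v} = f ` {v \<in> A. P v}"
    using assms(2) by auto
  have "inj_on f {v \<in> A. P v}"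
    using assms(1) by (rule inj_on_subset) auto
  then show ?thesis
    using False unfolding eq by (simp add: finite_image_iff)
qed

lemma elder_siblings_subset:
  assumes "distinct (names T)" "v \<in> nodes T"
  shows "elder_siblings T v \<subseteq> nodes T"
proof
  fix w assume "w \<in> elder_siblings T v"
  then obtain u i where "u \<in> nodes T" "i < length (kids T u)" "w = kids T u ! i"
    by (auto simp: elder_siblings_def intro: less_trans)
  then show "w \<in> nodes T" using kid_in_nodes[OF assms(1)] by simp
qed

section \<open>Invariance of the statistics under injective renaming\<close>

context
  fixes T :: "'v ptree" and f :: "'v \<Rightarrow> 'w"
  assumes d: "distinct (names T)" and inj: "inj_on f (nodes T)"
begin

lemma distinct_names_relabel: "distinct (names (relabel f T))"
  using d inj by (simp add: names_relabel distinct_map)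

lemma kids_relabel:
  assumes "v \<in> nodes T"
  shows "kids (relabel f T) (f v) = map f (kids T v)"
proof -
  obtain t where t: "t \<in> subptrees T" "proot t = v"
    using assms by (rule nodes_obtain_subptree)
  have "relabel f t \<in> subptrees (relabel f T)"
    using t(1) by (simp add: subptrees_relabel)
  from kids_subptree[OF distinct_names_relabel this] show ?thesis
    using kids_subptree[OF d t(1)] t(2) by (cases t) simp
qed

lemma elder_siblings_relabel:
  assumes "v \<in> nodes T"
  shows "elder_siblings (relabel f T) (f v) = f ` elder_siblings T v"
proof (cases "v = proot T")
  case True
  then show ?thesis
    using elder_siblings_root[OF d] elder_siblings_root[OF distinct_names_relabel] by simp
next
  case False
  then obtain u i where u: "u \<in> nodes T" "i < length (kids T u)" "v = kids T u ! i"
    using nodes_root_or_kid[OF d assms] by metis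
  have "f u \<in> nodes (relabel f T)" "i < length (kids (relabel f T) (f u))"
    "f v = kids (relabel f T) (f u) ! i"
    using u by (auto simp: ptree.set_map kids_relabel)
  from elder_siblings_kid[OF distinct_names_relabel this(1,2), folded this(3)]
  have "elder_siblings (relabel f T) (f v) = (!) (map f (kids T u)) ` {..<i}"
    using u(1) by (simp add: kids_relabel)
  also have "\<dots> = f ` (!) (kids T u) ` {..<i}"
    unfolding image_image using u(2) by (intro image_cong) auto
  finally show ?thesis
    using elder_siblings_kid[OF d u(1,2)] u(3) by simp
qed

lemma root_path_relabel:
  assumes "v \<in> nodes T"
  shows "root_path (relabel f T) (f v) = map f (root_path T v)"
  using d assms
proof (induction rule: nodes_kids_induct)
  case root
  then show ?case
    using root_path_root[OF d] root_path_root[OF distinct_names_relabel] by simp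
next
  case (kid u i)
  have "f u \<in> nodes (relabel f T)" "i < length (kids (relabel f T) (f u))"
    using kid by (auto simp: ptree.set_map kids_relabel)
  from root_path_kid[OF distinct_names_relabel this]
  show ?case using root_path_kid[OF d kid(1,2)] kid by (simp add: kids_relabel)
qed

lemma lev_relabel: "v \<in> nodes T \<Longrightarrow> lev (relabel f T) (f v) = lev T v"
  by (simp add: lev_def root_path_relabel)

lemma lsw_relabel:
  assumes "v \<in> nodes T"
  shows "lsw (relabel f T) (f v) = lsw T v"
proof -
  have "set (root_path T v) \<subseteq> nodes T"
    using path_to_root_root_path[OF d assms, of "root_path T v"] by (simp add: path_to_root_def)
  moreover have "card (elder_siblings (relabel f T) (f w)) = card (elder_siblings T w)"
    if "w \<in> nodes T" for w
    using elder_siblings_relabel[OF that] elder_siblings_subset[OF d that] inj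
    by (metis card_image inj_on_subset)
  ultimately have "(\<Sum>w\<leftarrow>root_path T v. card (elder_siblings (relabel f T) (f w))) =
      (\<Sum>w\<leftarrow>root_path T v. card (elder_siblings T w))"
    by (intro arg_cong[of _ _ sum_list] map_cong) auto
  then show ?thesis
    by (simp add: lsw_def deg_def kids_relabel[OF assms] root_path_relabel[OF assms] comp_def)
qed

end

lemma statistics_relabel:
  assumes d: "distinct (names T)" and inj: "inj_on f (nodes T)"
    and snd: "\<And>v. v \<in> nodes T \<Longrightarrow> snd (f v) = snd v"
  shows "Lev (relabel f T) = Lev T" "Lsw (relabel f T) = Lsw T" "Bro (relabel f T) = Bro T"
    "Par (relabel f T) = Par T" "Yle (relabel f T) = Yle T"
    "leaf_count (relabel f T) = leaf_count T" "int_count (relabel f T) = int_count T"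
proof -
  note kids = kids_relabel[OF d inj]
  have nodes: "nodes (relabel f T) = f ` nodes T" by (rule ptree.set_map)
  show "Lev (relabel f T) = Lev T"
    unfolding Lev_def nodes
    using image_mset_filter_reindex[OF inj, of "\<lambda>_. True" "\<lambda>_. True" "lev (relabel f T)" "lev T"]
      lev_relabel[OF d inj] by simp
  show "Lsw (relabel f T) = Lsw T"
    unfolding Lsw_def nodes
    using image_mset_filter_reindex[OF inj, of "\<lambda>_. True" "\<lambda>_. True" "lsw (relabel f T)" "lsw T"]
      lsw_relabel[OF d inj] by simp
  show "Bro (relabel f T) = Bro T"
    unfolding Bro_def nodes
  proof (rule image_mset_filter_reindex[OF inj])
    fix v assume v: "v \<in> nodes T"
    have "snd (f w) = snd w" if "w \<in> elder_siblings T v" for w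
      using elder_siblings_subset[OF d v] that snd by blast
    then show "(\<exists>w\<in>elder_siblings (relabel f T) (f v). snd w = snd (f v)) \<longleftrightarrow>
        (\<exists>w\<in>elder_siblings T v. snd w = snd v)"
      unfolding elder_siblings_relabel[OF d inj v] snd[OF v] by auto
  qed (rule snd)
  show "Par (relabel f T) = Par T"
    unfolding Par_def nodes
  proof (rule image_mset_filter_reindex[OF inj])
    fix v assume v: "v \<in> nodes T"
    then show "(\<exists>w\<in>set (kids (relabel f T) (f v)). snd w = snd (f v)) \<longleftrightarrow>
        (\<exists>w\<in>set (kids T v). snd w = snd v)"
      using kid_in_nodes[OF d v] snd by (auto simp: kids)
  qed (rule snd)
  show "Yle (relabel f T) = Yle T"
    unfolding Yle_def nodes
  proof (rule image_mset_filter_reindex[OF inj])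
    fix v assume v: "v \<in> nodes T"
    have "f v = last (map f (kids T u)) \<longleftrightarrow> v = last (kids T u)"
      if "u \<in> nodes T" "kids T u \<noteq> []" for u
    proof -
      \<comment> \<open>Since \<open>f\<close> is injective only on \<open>nodes T\<close>, both
        sides must be known to be nodes before \<open>f\<close> can be cancelled.\<close>
      have "last (kids T u) \<in> nodes T"
        using kid_in_nodes[OF d that(1)] that(2) by simp
      then show ?thesis using that(2) v inj by (auto simp: last_map dest: inj_onD)
    qed
    then show "(kids (relabel f T) (f v) = [] \<and>
          (\<exists>u\<in>f ` nodes T. kids (relabel f T) u \<noteq> [] \<and> f v = last (kids (relabel f T) u))) \<longleftrightarrow>
        (kids T v = [] \<and> (\<exists>u\<in>nodes T. kids T u \<noteq> [] \<and> v = last (kids T u)))"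
      using v by (auto simp: kids)
  qed (rule snd)
  have "{v \<in> nodes (relabel f T). kids (relabel f T) v = []} = f ` {v \<in> nodes T. kids T v = []}"
    "{v \<in> nodes (relabel f T). kids (relabel f T) v \<noteq> []} = f ` {v \<in> nodes T. kids T v \<noteq> []}"
    unfolding nodes by (auto simp: kids)
  moreover have "inj_on f {v \<in> nodes T. P v}" for P
    using inj by (rule inj_on_subset) auto
  ultimately show "leaf_count (relabel f T) = leaf_count T" "int_count (relabel f T) = int_count T"
    unfolding leaf_count_def int_count_def by (simp_all add: card_image)
qed

section \<open>Weakly increasing labels\<close>

text \<open>Parent and children form one sorted list, so both sortedness conditions become a
  condition at single nodes. The key \<open>k\<close> serves label trees (\<open>id\<close>) and
  named trees (\<open>snd\<close>) alike.\<close>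

definition locally_sorted :: "('v \<Rightarrow> 'a::linorder) \<Rightarrow> 'v ptree \<Rightarrow> bool" where
  "locally_sorted k T \<longleftrightarrow> (\<forall>t\<in>subptrees T. sorted (map k (proot t # map proot (branches t))))"

lemma locally_sorted_PNode:
  "locally_sorted k (PNode x ts) \<longleftrightarrow>
     sorted (map k (x # map proot ts)) \<and> (\<forall>b\<in>set ts. locally_sorted k b)"
  by (auto simp: locally_sorted_def)

lemma locally_sorted_root_le:
  "locally_sorted k T \<Longrightarrow> v \<in> nodes T \<Longrightarrow> k (proot T) \<le> k v"
proof (induction T)
  case (PNode x ts)
  show ?case
  proof (cases "v = x")
    case False
    then obtain b where b: "b \<in> set ts" "v \<in> nodes b"
      using PNode.prems(2) by auto
    then have "k x \<le> k (proot b)" "locally_sorted k b"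
      using PNode.prems(1) by (auto simp: locally_sorted_PNode)
    then show ?thesis using PNode.IH[OF b(1) _ b(2)] by (auto intro: order_trans)
  qed simp
qed

lemma set_tree_forest_to_bin: "set_tree (forest_to_bin ts) = (\<Union>t\<in>set ts. nodes t)"
  by (induction ts rule: forest_to_bin.induct) auto

text \<open>Below \<open>x\<close> in the binary tree lie the trees of its children and of its
  younger siblings. When these are locally sorted, their roots are minimal, so comparing
  \<open>x\<close> with all nodes reduces to comparing it with the roots.\<close>

lemma heap_forest_to_bin:
  "heap (map_tree k (forest_to_bin ts)) \<longleftrightarrow>
     sorted (map (\<lambda>t. k (proot t)) ts) \<and> (\<forall>b\<in>set ts. locally_sorted k b)"
proof (induction ts rule: forest_to_bin.induct)
  case (2 x cs ts)
  have le: "(\<forall>v\<in>\<Union>(nodes ` set us). k x \<le> k v) \<longleftrightarrow> (\<forall>b\<in>set us. k x \<le> k (proot b))"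
    if "\<forall>b\<in>set us. locally_sorted k b" for us
  proof
    assume "\<forall>b\<in>set us. k x \<le> k (proot b)"
    then show "\<forall>v\<in>\<Union>(nodes ` set us). k x \<le> k v"
      using that locally_sorted_root_le by (metis UN_E order_trans)
  qed auto
  have "heap (map_tree k (forest_to_bin (PNode x cs # ts))) \<longleftrightarrow>
      (\<forall>v\<in>\<Union>(nodes ` set cs). k x \<le> k v) \<and> (\<forall>v\<in>\<Union>(nodes ` set ts). k x \<le> k v) \<and>
      heap (map_tree k (forest_to_bin cs)) \<and> heap (map_tree k (forest_to_bin ts))"
    unfolding forest_to_bin.simps tree.map heap.simps tree.set_map set_tree_forest_to_bin by blast
  also have "\<dots> \<longleftrightarrow> (\<forall>b\<in>set cs. k x \<le> k (proot b)) \<and> (\<forall>b\<in>set ts. k x \<le> k (proot b)) \<and>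
      heap (map_tree k (forest_to_bin cs)) \<and> heap (map_tree k (forest_to_bin ts))"
    using 2 le[of cs] le[of ts] by blast
  finally show ?case
    unfolding 2 by (auto simp: locally_sorted_PNode comp_def)
qed simp

text \<open>The root of \<open>T\<close> is missing from \<open>phi T\<close>, so its comparison
  with the other nodes is a separate condition; it too depends only on the node set.\<close>

lemma locally_sorted_iff_heap:
  "locally_sorted k T \<longleftrightarrow>
     heap (map_tree k (phi T)) \<and> (\<forall>v\<in>set_tree (phi T). k (proot T) \<le> k v)"
proof
  assume *: "locally_sorted k T"
  then show "heap (map_tree k (phi T)) \<and> (\<forall>v\<in>set_tree (phi T). k (proot T) \<le> k v)"
    using locally_sorted_root_le[OF *]
    by (cases T) (auto simp: phi_def heap_forest_to_bin locally_sorted_PNode comp_def set_tree_forest_to_bin)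
next
  assume "heap (map_tree k (phi T)) \<and> (\<forall>v\<in>set_tree (phi T). k (proot T) \<le> k v)"
  then show "locally_sorted k T"
    by (cases T) (auto simp: phi_def heap_forest_to_bin locally_sorted_PNode comp_def set_tree_forest_to_bin)
qed

lemma heap_mirror: "heap (mirror B) \<longleftrightarrow> heap B"
  by (induction B) (auto simp: set_tree_mirror)

lemma locally_sorted_phi_tilde: "locally_sorted k (phi_tilde T) \<longleftrightarrow> locally_sorted k T"
  by (simp add: locally_sorted_iff_heap phi_phi_tilde map_mirror heap_mirror set_tree_mirror)

lemma locally_sorted_kids:
  assumes "distinct (names T)"
  shows "locally_sorted k T \<longleftrightarrow> (\<forall>u\<in>nodes T. sorted (map k (u # kids T u)))"
  unfolding locally_sorted_def proot_image_subptrees[symmetric]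
  using kids_subptree[OF assms] by simp

text \<open>\<open>wi_trees\<close> requires sorted labels only on paths ending in leaves; extending
  a path to a leaf puts every edge on such a path.\<close>

lemma leaf_below:
  assumes d: "distinct (names T)" and "v \<in> nodes T"
  obtains w xs where "w \<in> nodes T" "kids T w = []" "root_path T w = xs @ root_path T v"
proof -
  have "\<exists>w\<in>nodes T. kids T w = [] \<and> (\<exists>xs. root_path T w = xs @ root_path T (proot t))"
    if "t \<in> subptrees T" for t
    using that
  proof (induction t)
    case (PNode x ts)
    note kids = kids_subptree[OF d PNode.prems]
    have x: "x \<in> nodes T" using proot_in_nodes_subptree[OF PNode.prems] by simp
    show ?case
    proof (cases ts)
      case Nil
      then show ?thesis using kids x by auto
    next
      case (Cons b bs)
      have "b \<in> subptrees T"
        using PNode.prems by (rule subptrees_branch) (simp add: Cons)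
      then obtain w xs where w: "w \<in> nodes T" "kids T w = []"
          "root_path T w = xs @ root_path T (proot b)"
        using PNode.IH[of b] Cons by auto
      moreover have "root_path T (proot b) = proot b # root_path T x"
        using root_path_kid[OF d x, of 0] kids Cons by simp
      ultimately show ?thesis
        by (intro bexI[of _ w]) auto
    qed
  qed
  then show ?thesis
    using nodes_obtain_subptree[OF assms(2)] that by metis
qed

lemma sorted_root_paths_iff:
  assumes d: "distinct (names T)"
  shows "(\<forall>v\<in>nodes T. kids T v = [] \<longrightarrow> sorted (rev (map k (root_path T v)))) \<and>
      (\<forall>v\<in>nodes T. sorted (map k (kids T v))) \<longleftrightarrow> locally_sorted k T" (is "?L \<longleftrightarrow> ?R")
proof
  assume L: ?L
  have "k u \<le> k v" if u: "u \<in> nodes T" "v \<in> set (kids T u)" for u v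
  proof -
    obtain i where i: "i < length (kids T u)" "v = kids T u ! i"
      using u(2) by (metis in_set_conv_nth)
    obtain w xs where w: "w \<in> nodes T" "kids T w = []" "root_path T w = xs @ root_path T v"
      using leaf_below[OF d kid_in_nodes[OF d u]] by metis
    moreover obtain ys where "root_path T u = u # ys"
      using root_path_hd[OF d u(1)] by metis
    moreover have "root_path T v = v # root_path T u"
      using root_path_kid[OF d u(1) i(1)] i(2) by simp
    ultimately have "sorted (rev (map k (xs @ v # u # ys)))"
      using L by metis
    then show ?thesis by (simp add: sorted_append)
  qed
  then show ?R using L by (simp add: locally_sorted_kids[OF d])
next
  assume R: ?R
  then have le: "\<And>u v. u \<in> nodes T \<Longrightarrow> v \<in> set (kids T u) \<Longrightarrow> k u \<le> k v"
    and so: "\<forall>v\<in>nodes T. sorted (map k (kids T v))"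
    by (auto simp: locally_sorted_kids[OF d])
  have "sorted (rev (map k (root_path T v)))" if "v \<in> nodes T" for v
    using d that
  proof (induction rule: nodes_kids_induct)
    case root
    then show ?case by (simp add: root_path_root[OF d])
  next
    case (kid u i)
    obtain ys where ys: "root_path T u = u # ys"
      using root_path_hd[OF d kid(1)] by metis
    have "k u \<le> k (kids T u ! i)"
      using le[OF kid(1)] kid(2) by simp
    then show ?case
      using kid(3) root_path_kid[OF d kid(1,2)] ys
      by (auto simp: sorted_append intro: order_trans)
  qed
  then show ?L using so by blast
qed

lemma map_tree_phi: "phi (relabel f T) = map_tree f (phi T)"
proof -
  have "forest_to_bin (map (relabel f) ts) = map_tree f (forest_to_bin ts)" for ts
    by (induction ts rule: forest_to_bin.induct) auto
  then show ?thesis by (cases T) (simp add: phi_def)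
qed

text \<open>The conditions see labels only, so the addresses drop out and membership is expressed
  for \<open>T\<close> itself, on which \<open>phi_tilde\<close> acts.\<close>

lemma wi_trees_iff:
  "T \<in> wi_trees M \<longleftrightarrow> mset (names T) = add_mset 0 M \<and> locally_sorted id T"
proof -
  let ?N = "addressed T"
  have T: "relabel snd ?N = T" by (rule relabel_snd_addressed)
  have "mset_set (nodes ?N) = mset (names ?N)"
    using mset_set_set[OF distinct_names_addressed, of T] by simp
  then have "image_mset snd (mset_set (nodes ?N)) = mset (names T)"
    using names_relabel[of snd ?N] T by simp
  moreover have "locally_sorted snd ?N \<longleftrightarrow> locally_sorted id T"
    using map_tree_phi[of snd ?N] proot_relabel[of snd ?N]
    unfolding T locally_sorted_iff_heap by (simp add: tree.set_map tree.map_id)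
  ultimately show ?thesis
    unfolding wi_trees_def Let_def using sorted_root_paths_iff[OF distinct_names_addressed, of T snd]
    by simp
qed

lemma mset_names_phi_tilde: "mset (names (phi_tilde T)) = mset (names T)"
  by (simp add: names_phi phi_phi_tilde mset_preorder_mirror)

lemma phi_tilde_wi_trees: "phi_tilde T \<in> wi_trees M \<longleftrightarrow> T \<in> wi_trees M"
  by (simp add: wi_trees_iff mset_names_phi_tilde locally_sorted_phi_tilde)

section \<open>The statistics of the mirror image\<close>

lemma Yle_phi_tilde:
  assumes d: "distinct (names T)"
  shows "Yle (phi_tilde T) = Yle T"
proof -
  have *: "{v \<in> nodes S. kids S v = [] \<and> (\<exists>u\<in>nodes S. kids S u \<noteq> [] \<and> v = last (kids S u))} =
      {v \<in> set_tree (phi S). (\<nexists>y. left_child (phi S) v y) \<and> (\<nexists>y. right_child (phi S) v y)}"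
    if "distinct (names S)" for S :: "('a \<times> nat) ptree"
    using no_left_child_phi_iff[OF that] no_right_child_phi_iff[OF that] in_set_tree_phi[OF that]
    by blast
  show ?thesis
    unfolding Yle_def *[OF d] *[OF distinct_names_phi_tilde[OF d]]
    by (simp add: phi_phi_tilde left_child_mirror right_child_mirror set_tree_mirror conj_commute)
qed

text \<open>Children are sorted, so an elder sibling with the label of \<open>v\<close> squeezes the
  closest elder sibling, at position \<open>i - 1\<close>, to that label too. It therefore suffices
  to look at one right step.\<close>

lemma Bro_eq:
  assumes d: "distinct (names T)" and s: "locally_sorted snd T"
  shows "Bro T = image_mset snd (mset_set {v. \<exists>x. right_child (phi T) x v \<and> snd x = snd v})"
proof -
  have "(v \<in> nodes T \<and> (\<exists>w\<in>elder_siblings T v. snd w = snd v)) \<longleftrightarrow>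
      (\<exists>x. right_child (phi T) x v \<and> snd x = snd v)" (is "?L \<longleftrightarrow> ?R") for v
  proof
    assume ?L
    then obtain w where w: "v \<in> nodes T" "w \<in> elder_siblings T v" "snd w = snd v" by blast
    then have "v \<noteq> proot T" using elder_siblings_root[OF d] by auto
    then obtain u i where u: "u \<in> nodes T" "i < length (kids T u)" "v = kids T u ! i"
      using nodes_root_or_kid[OF d w(1)] by metis
    then obtain j where j: "j < i" "w = kids T u ! j"
      using w(2) elder_siblings_kid[OF d u(1,2)] by auto
    have so: "sorted (map snd (kids T u))"
      using s u(1) by (simp add: locally_sorted_kids[OF d])
    have "snd w \<le> snd (kids T u ! (i - 1))" "snd (kids T u ! (i - 1)) \<le> snd v"
      using sorted_nth_mono[OF so, of j "i - 1"] sorted_nth_mono[OF so, of "i - 1" i] u(2,3) j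
      by auto
    moreover have "right_child (phi T) (kids T u ! (i - 1)) v"
      unfolding right_child_phi_kids[OF d] using u j
      by (intro bexI[of _ u] exI[of _ "i - 1"]) auto
    ultimately show ?R using w(3) by (metis order_antisym)
  next
    assume ?R
    then obtain u i where u: "u \<in> nodes T" "Suc i < length (kids T u)"
        "v = kids T u ! Suc i" "snd (kids T u ! i) = snd v"
      unfolding right_child_phi_kids[OF d] by blast
    then have "v \<in> nodes T" "kids T u ! i \<in> elder_siblings T v"
      using elder_siblings_kid[OF d u(1,2)] kid_in_nodes[OF d u(1)] by auto
    then show ?L using u(4) by blast
  qed
  then show ?thesis unfolding Bro_def by presburger
qed

text \<open>Sortedness squeezes the first child to the label of \<open>x\<close> as soon as some
  child has it. The strict inequality \<open>r\<close> prevents the root of \<open>T\<close> from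
  being a repeated parent, which no left step of \<open>phi T\<close> would record.\<close>

lemma Par_eq:
  assumes d: "distinct (names T)" and s: "locally_sorted snd T"
    and r: "\<forall>v\<in>set_tree (phi T). snd (proot T) < snd v"
  shows "Par T = image_mset snd (mset_set {x. \<exists>v. left_child (phi T) x v \<and> snd x = snd v})"
proof -
  have "(x \<in> nodes T \<and> (\<exists>w\<in>set (kids T x). snd w = snd x)) \<longleftrightarrow>
      (\<exists>v. left_child (phi T) x v \<and> snd x = snd v)" (is "?L \<longleftrightarrow> ?R") for x
  proof
    assume ?L
    then obtain i where i: "x \<in> nodes T" "i < length (kids T x)" "snd (kids T x ! i) = snd x"
      by (metis in_set_conv_nth)
    have "x \<noteq> proot T"
      using r kid_in_set_tree_phi[OF d i(1,2)] i(3) by auto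
    have so: "sorted (map snd (x # kids T x))"
      using s i(1) unfolding locally_sorted_kids[OF d] by blast
    have len: "0 < length (kids T x)" using i(2) by linarith
    have "snd x \<le> snd (kids T x ! 0)" "snd (kids T x ! 0) \<le> snd (kids T x ! i)"
      using sorted_nth_mono[OF so, of 0 1] sorted_nth_mono[OF so, of 1 "Suc i"] i(2) len
      by (auto simp: nth_map)
    moreover have "left_child (phi T) x (kids T x ! 0)"
      unfolding left_child_phi_kids[OF d] using i len \<open>x \<noteq> proot T\<close> by simp
    ultimately show ?R using i(3) by (metis order_antisym)
  next
    assume ?R
    then show ?L
      unfolding left_child_phi_kids[OF d] by (metis nth_mem)
  qed
  then show ?thesis unfolding Par_def by presburger
qed

text \<open>Both sides run over the right steps of \<open>phi T\<close> joining equal labels: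
  \<open>Bro T\<close> records the lower end, \<open>Par (phi_tilde T)\<close> the upper one. Either
  end determines the other, and their labels agree.\<close>

lemma Bro_Par_phi_tilde:
  assumes d: "distinct (names T)" and s: "locally_sorted snd T"
    and r: "\<forall>v\<in>set_tree (phi T). snd (proot T) < snd v"
  shows "Par (phi_tilde T) = Bro T"
proof -
  let ?A = "{v. \<exists>x. right_child (phi T) x v \<and> snd x = snd v}"
  \<comment> \<open>The closest elder sibling of \<open>v\<close> in \<open>T\<close>, if there is
    one.\<close>
  define f where "f v = (THE x. right_child (phi T) x v)" for v
  have f: "f v = x" if x: "right_child (phi T) x v" for x v
    unfolding f_def
  proof (rule the_equality)
    show "x' = x" if "right_child (phi T) x' v" for x'
      using that x kids_position_unique[OF d]
      unfolding right_child_phi_kids[OF d] by (metis nat.inject)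
  qed (rule x)
  have next_eq: "v = v'" if "right_child (phi T) x v" "right_child (phi T) x v'" for x v v'
    using that kids_position_unique[OF d] unfolding right_child_phi_kids[OF d]
    by (metis Suc_lessD)
  have inj: "inj_on f ?A"
  proof (rule inj_onI)
    fix v v' assume "v \<in> ?A" "v' \<in> ?A" and eq: "f v = f v'"
    then obtain x x' where "right_child (phi T) x v" "right_child (phi T) x' v'" by blast
    then show "v = v'" using f next_eq eq by metis
  qed
  have "Par (phi_tilde T) =
      image_mset snd (mset_set {x. \<exists>v. right_child (phi T) x v \<and> snd x = snd v})"
    using Par_eq[OF distinct_names_phi_tilde[OF d]] s r
    by (simp add: phi_phi_tilde left_child_mirror set_tree_mirror locally_sorted_phi_tilde)
  also have "{x. \<exists>v. right_child (phi T) x v \<and> snd x = snd v} = f ` ?A"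
  proof (intro equalityI subsetI)
    fix x assume "x \<in> {x. \<exists>v. right_child (phi T) x v \<and> snd x = snd v}"
    then obtain v where "right_child (phi T) x v" "snd x = snd v" by blast
    then show "x \<in> f ` ?A" using f by blast
  next
    fix x assume "x \<in> f ` ?A"
    then obtain v x' where "x = f v" "right_child (phi T) x' v" "snd x' = snd v" by blast
    then show "x \<in> {x. \<exists>v. right_child (phi T) x v \<and> snd x = snd v}" using f by blast
  qed
  also have "image_mset snd (mset_set (f ` ?A)) = image_mset snd (mset_set ?A)"
  proof -
    have "snd (f v) = snd v" if "v \<in> ?A" for v
      using that f by blast
    then show ?thesis
      using image_mset_filter_reindex[OF inj, of "\<lambda>_. True" "\<lambda>_. True" snd snd] by simp
  qed
  also have "\<dots> = Bro T" using Bro_eq[OF d s] ..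
  finally show ?thesis .
qed

lemma statistics_phi_tilde:
  assumes d: "distinct (names T)" and s: "locally_sorted snd T"
    and r: "\<forall>v\<in>set_tree (phi T). snd (proot T) < snd v" and ne: "nodes T \<noteq> {proot T}"
  shows "(Lev T, Lsw T, Bro T, Par T, Yle T, leaf_count T, int_count T) =
    (\<lambda>S. (Lsw S, Lev S, Par S, Bro S, Yle S, int_count S, leaf_count S)) (phi_tilde T)"
proof -
  obtain f where f: "bij_betw f (nodes T) (nodes T)" "\<And>v. v \<in> nodes T \<Longrightarrow> leads_to T v (f v)"
    using leads_to_bij[OF d ne] by metis
  have inj: "inj_on f (nodes T)" and im: "f ` nodes T = nodes T"
    using f(1) by (auto simp: bij_betw_def)
  note st = leads_to_statistics[OF d f(2)]
  have ms: "image_mset (g \<circ> f) (mset_set (nodes T)) = image_mset g (mset_set (nodes T))"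
    for g :: "'a \<times> nat \<Rightarrow> nat"
    using image_mset_mset_set[OF inj] im by (simp flip: multiset.map_comp)
  have "Lev T = Lsw (phi_tilde T)" "Lsw T = Lev (phi_tilde T)"
    unfolding Lev_def Lsw_def nodes_phi_tilde
      ms[of "lsw (phi_tilde T)", symmetric] ms[of "lev (phi_tilde T)", symmetric]
    by (rule image_mset_cong, simp add: st finite_nodes)+
  moreover have "Bro T = Par (phi_tilde T)"
    using Bro_Par_phi_tilde[OF d s r] ..
  moreover have "Par T = Bro (phi_tilde T)"
    using Bro_Par_phi_tilde[OF distinct_names_phi_tilde[OF d]] s r
    by (simp add: locally_sorted_phi_tilde phi_phi_tilde set_tree_mirror)
  moreover have "Yle T = Yle (phi_tilde T)"
    using Yle_phi_tilde[OF d] ..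
  moreover have "leaf_count T = int_count (phi_tilde T)" "int_count T = leaf_count (phi_tilde T)"
  proof -
    have k: "kids (phi_tilde T) (f v) = [] \<longleftrightarrow> kids T v \<noteq> []" if "v \<in> nodes T" for v
      using leads_to_nodes(3)[OF d f(2)[OF that]] .
    have "f ` {v \<in> nodes T. kids T v = []} = {u \<in> f ` nodes T. kids (phi_tilde T) u \<noteq> []}"
      "f ` {v \<in> nodes T. kids T v \<noteq> []} = {u \<in> f ` nodes T. kids (phi_tilde T) u = []}"
      using k by auto
    note eq = this[unfolded im, symmetric]
    have "card (f ` {v \<in> nodes T. P v}) = card {v \<in> nodes T. P v}" for P
      using inj by (intro card_image inj_on_subset[OF inj]) auto
    then show "leaf_count T = int_count (phi_tilde T)" "int_count T = leaf_count (phi_tilde T)"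
      unfolding leaf_count_def int_count_def nodes_phi_tilde eq by simp_all
  qed
  ultimately show ?thesis by simp
qed

text \<open>Meant for \<open>T = phi_tilde (addressed S)\<close>, where \<open>relabel snd T\<close>
  is \<open>phi_tilde S\<close>: then \<open>T\<close> keeps the addresses of \<open>S\<close>,
  while \<open>N\<close> has those of the mirrored tree.\<close>

lemma statistics_addressed_relabel_snd:
  assumes d: "distinct (names T)"
  defines "N \<equiv> addressed (relabel snd T)"
  shows "Lev N = Lev T" "Lsw N = Lsw T" "Bro N = Bro T" "Par N = Par T" "Yle N = Yle T"
    "leaf_count N = leaf_count T" "int_count N = int_count T"
proof -
  obtain f where f: "relabel f N = T" "\<forall>z\<in>nodes N. snd (f z) = snd z"
    using relabel_addressed[of snd T] unfolding N_def by blast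
  \<comment> \<open>The names of \<open>T\<close> are the images under \<open>f\<close> of those of
    \<open>N\<close>, and their distinctness forces injectivity.\<close>
  have inj: "inj_on f (nodes N)"
    using d unfolding f(1)[symmetric] names_relabel distinct_map by simp
  have dN: "distinct (names N)"
    unfolding N_def by (rule distinct_names_addressed)
  have snd: "snd (f v) = snd v" if "v \<in> nodes N" for v
    using f(2) that by blast
  note stats = statistics_relabel[OF dN inj snd, unfolded f(1)]
  show "Lev N = Lev T" "Lsw N = Lsw T" "Bro N = Bro T" "Par N = Par T" "Yle N = Yle T"
    "leaf_count N = leaf_count T" "int_count N = int_count T"
    by (rule stats[symmetric]; assumption)+
qed

text \<open>Some node carries 0, and local sortedness gives the root a least label.\<close>

lemma wi_trees_root_labels:
  assumes "T \<in> wi_trees M" "0 \<notin># M"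
  shows "proot T = 0 \<and> set_tree (phi T) = set_mset M"
proof -
  have m: "mset (names T) = add_mset 0 M" and s: "locally_sorted id T"
    using assms(1) by (auto simp: wi_trees_iff)
  have "0 \<in> nodes T"
    using arg_cong[OF m, of set_mset] by simp
  then have "proot T = 0"
    using locally_sorted_root_le[OF s, of 0] by simp
  moreover from this have "mset (preorder (phi T)) = M"
    using m by (simp add: names_phi)
  then have "set_tree (phi T) = set_mset M"
    by (metis set_mset_mset set_preorder)
  ultimately show ?thesis by simp
qed

theorem theorem2p5:
  fixes n :: nat and p :: "nat \<Rightarrow> nat" and M :: "nat multiset"
  assumes "n \<ge> 1"
    and "\<forall>i\<in>{1..n}. p i \<ge> 1"
    and "M = (\<Sum>i\<in>{1..n}. replicate_mset (p i) i)"
  shows "(\<forall>T\<in>wi_trees M. \<forall>v\<in>nodes (addressed T). \<forall>u.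
            leads_to (addressed T) v u \<longrightarrow>
              lev (addressed T) v = lsw (phi_tilde (addressed T)) u \<and>
              lsw (addressed T) v = lev (phi_tilde (addressed T)) u \<and>
              deg (addressed T) v = deg_tilde (phi_tilde (addressed T)) u) \<and>
         same_distribution (wi_trees M)
           ((\<lambda>T. (Lev T, Lsw T, Bro T, Par T, Yle T, leaf_count T, int_count T)) \<circ> addressed)
           ((\<lambda>T. (Lsw T, Lev T, Par T, Bro T, Yle T, int_count T, leaf_count T)) \<circ> addressed)"
proof (intro conjI ballI allI impI)
  let ?F = "(\<lambda>T. (Lev T, Lsw T, Bro T, Par T, Yle T, leaf_count T, int_count T)) \<circ> addressed"
  let ?G = "(\<lambda>T. (Lsw T, Lev T, Par T, Bro T, Yle T, int_count T, leaf_count T)) \<circ> addressed"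
  have "set_mset M = (\<Union>i\<in>{1..n}. set_mset (replicate_mset (p i) i))"
    unfolding assms(3) by (simp add: set_mset_sum)
  then have M: "set_mset M = {1..n}"
    using assms(2) by (force simp: in_replicate_mset)
  \<comment> \<open>An identity tree by tree; since \<open>phi_tilde\<close> is an involution of
    \<open>wi_trees M\<close>, it gives bijections between the fibres of the two septuples.\<close>
  have FG: "?F T = ?G (phi_tilde T)" if T: "T \<in> wi_trees M" for T
  proof -
    let ?N = "addressed T"
    have rel: "relabel snd ?N = T" by (rule relabel_snd_addressed)
    have d: "distinct (names ?N)" by (rule distinct_names_addressed)
    have phi: "phi T = map_tree snd (phi ?N)" "proot T = snd (proot ?N)"
      using map_tree_phi[of snd ?N] proot_relabel[of snd ?N] rel by auto
    have root: "proot T = 0" "set_tree (phi T) = {1..n}"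
      using wi_trees_root_labels[OF T] M by auto
    have "locally_sorted id T" using T by (simp add: wi_trees_iff)
    then have s: "locally_sorted snd ?N"
      using phi by (simp add: locally_sorted_iff_heap tree.set_map tree.map_id)
    have lab: "snd ` set_tree (phi ?N) = {1..n}"
      using root(2) phi(1) by (simp add: tree.set_map)
    have "0 < snd v" if "v \<in> set_tree (phi ?N)" for v
      using imageI[OF that, of snd] unfolding lab by simp
    then have r: "\<forall>v\<in>set_tree (phi ?N). snd (proot ?N) < snd v"
      using root(1) phi(2) by simp
    \<comment> \<open>As \<open>n\<close> is at least 1, the label 1 occurs, so the tree is not a
      lone root and every node leads somewhere.\<close>
    have "set_tree (phi ?N) \<noteq> {}"
      using lab assms(1) by force
    then have ne: "nodes ?N \<noteq> {proot ?N}"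
      using in_set_tree_phi[OF d] by blast
    \<comment> \<open>\<open>phi_tilde ?N\<close> and \<open>addressed (phi_tilde T)\<close> are two
      namings of the same label tree, so their statistics agree.\<close>
    have "relabel snd (phi_tilde ?N) = phi_tilde T"
      using phi_tilde_relabel[of snd ?N] rel by simp
    then show ?thesis
      using statistics_phi_tilde[OF d s r ne]
        statistics_addressed_relabel_snd[OF distinct_names_phi_tilde[OF d]] by simp
  qed
  show "same_distribution (wi_trees M) ?F ?G"
    unfolding same_distribution_def
  proof
    fix z
    have "bij_betw phi_tilde {T \<in> wi_trees M. ?F T = z} {T \<in> wi_trees M. ?G T = z}"
    proof (rule bij_betw_byWitness[where f' = phi_tilde])
      show "phi_tilde ` {T \<in> wi_trees M. ?F T = z} \<subseteq> {T \<in> wi_trees M. ?G T = z}"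
      proof
        fix S assume "S \<in> phi_tilde ` {T \<in> wi_trees M. ?F T = z}"
        then obtain T where T: "S = phi_tilde T" "T \<in> wi_trees M" "?F T = z" by blast
        then have "S \<in> wi_trees M" by (simp only: phi_tilde_wi_trees)
        moreover have "?G S = z" using FG[OF T(2)] T(1,3) by (simp only:)
        ultimately show "S \<in> {T \<in> wi_trees M. ?G T = z}" by blast
      qed
      show "phi_tilde ` {T \<in> wi_trees M. ?G T = z} \<subseteq> {T \<in> wi_trees M. ?F T = z}"
      proof
        fix S assume "S \<in> phi_tilde ` {T \<in> wi_trees M. ?G T = z}"
        then obtain T where T: "S = phi_tilde T" "T \<in> wi_trees M" "?G T = z" by blast
        then have "S \<in> wi_trees M" by (simp only: phi_tilde_wi_trees)
        moreover from FG[OF this] have "?F S = z"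
          using T by (simp only: phi_tilde_phi_tilde)
        ultimately show "S \<in> {T \<in> wi_trees M. ?F T = z}" by blast
      qed
    qed simp_all
    then show "card {T \<in> wi_trees M. ?F T = z} = card {T \<in> wi_trees M. ?G T = z}"
      by (rule bij_betw_same_card)
  qed
qed (use leads_to_statistics[OF distinct_names_addressed] in blast)+

end
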